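(* Let $\Lambda$ be a strongly connected finite $k$-graph. For each fixed $j \in \mathbb{N}_+=\{1,2,\dots\}$ and $v\in\Lambda^0,$ let $$C_{j,v}:= \{\lambda \in \Lambda: s(\lambda)=v,\ d(\lambda) = (j,j, \ldots, j)\}.$$ Let $S_\lambda$ be the operators on $L^2(\Lambda^\infty, M)$, and $f^{m,v}$ the functions, defined in the context. Then for each fixed $j\in\mathbb N_+$ $$\{S_\lambda f^{m,v}: v \in \Lambda^0, \;\lambda \in C_{j,v},\; 1 \leq m \leq d_v-1\}$$ is an orthonormal set, and moreover, if $\lambda \in C_{j,v},\; \mu \in C_{i,v'}$ for $0<i<j,$ we have $$ \int_{\Lambda^\infty} S_\lambda f^{m,v}\, \overline{S_\mu f^{m',v'}} \, dM = 0 \quad \text{for all } m, m'.$$ It follows that defining $$\mathcal W_{j,\Lambda} := \overline{\mathrm{span}}\{S_\lambda f^{m,v}: v \in \Lambda^0,\ \lambda \in C_{j,v},\ 1 \leq m \leq d_v-1\}$$ for $j \geq 1$, we obtain an orthonormal decomposition $$L^2(\Lambda^\infty, M) = \overline{\mathrm{span}}\;S = \mathcal V_{0,\Lambda}\oplus \bigoplus_{j=0}^\infty \mathcal W_{j,\Lambda}.$$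
   Context: Notation: $\mathbb N=\{0,1,2,\dots\}$, $k\ge 1$, and $e_1,\dots,e_k$ are the generators of $\mathbb N^k$. $k$-graphs: A $k$-graph is a countable category $\Lambda$ with a functor $d:\Lambda\to\mathbb N^k$ satisfying the factorization property: whenever $d(\lambda)=m+n$ there are unique $\mu,\nu\in\Lambda$ with $\lambda=\mu\nu$, $d(\mu)=m$, $d(\nu)=n$. $\Lambda^0$ is the set of identity morphisms (vertices), $r,s:\Lambda\to\Lambda^0$ are the range and source maps, $\Lambda^n=\{\lambda: d(\lambda)=n\}$, $v\Lambda w=\{\lambda: r(\lambda)=v, s(\lambda)=w\}$. $\Lambda$ is finite if every $\Lambda^n$ is finite; strongly connected if $v\Lambda w\neq\emptyset$ for all $v,w\in\Lambda^0$. The vertex matrices are $A_i\in M_{\Lambda^0}(\mathbb N)$, $A_i(v,w)=|v\Lambda^{e_i}w|$. Infinite paths: $\Omega_k=\{(p,q)\in\mathbb N^k\times\mathbb N^k: p\le q\}$ is the $k$-graph with $r(p,q)=p$, $s(p,q)=q$, $(p,q)(q,m)=(p,m)$, $d(p,q)=q-p$. An infinite path is a $k$-graph morphism (degree-preserving functor) $x:\Omega_k\to\Lambda$; $\Lambda^\infty$ is the set of them, with topology having as basis the cylinder sets $Z(\lambda)=\{x\in\Lambda^\infty: x(0,d(\lambda))=\lambda\}$. The shift is $\sigma^p(x)(m,n)=x(m+p,n+p)$, and $\sigma_\lambda:Z(s(\lambda))\to Z(\lambda)$, $\sigma_\lambda(x)=\lambda x$, is the inverse of $\sigma^{d(\lambda)}|_{Z(\lambda)}$.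 Perron-Frobenius measure: $x^\Lambda$ denotes the unique vector with positive entries and $\ell^1$-norm one such that $A_ix^\Lambda=\rho(A_i)x^\Lambda$ for all $i$, where $\rho(A_i)$ is the spectral radius. Put $\rho(\Lambda)=(\rho(A_1),\dots,\rho(A_k))$ and $\rho(\Lambda)^n=\prod_i\rho(A_i)^{n_i}$. $M$ is the Borel probability measure on $\Lambda^\infty$ with $M(Z(\lambda))=\rho(\Lambda)^{-d(\lambda)}x^\Lambda_{s(\lambda)}$ for all $\lambda\in\Lambda$. Operators: For $\lambda\in\Lambda$, $S_\lambda\in B(L^2(\Lambda^\infty,M))$ is $S_\lambda\xi(x)=\chi_{Z(\lambda)}(x)\,(\Phi_{\sigma_\lambda}(\sigma^{d(\lambda)}(x)))^{-1/2}\,\xi(\sigma^{d(\lambda)}(x))$, where $\Phi_{\sigma_\lambda}=\frac{d(M\circ\sigma_\lambda)}{dM}$ is the Radon-Nikodym derivative on $Z(s(\lambda))$. Spaces and functions: $\Theta_\lambda$ is the characteristic function of $Z(\lambda)$. $S=\{\Theta_\lambda: d(\lambda)=(n,n,\dots,n)\text{ for some }n\in\mathbb N\}$. $\mathcal V_{0,\Lambda}=\overline{\mathrm{span}}\{\frac1{\sqrt{x^\Lambda_v}}\Theta_v: v\in\Lambda^0\}$. For $v\in\Lambda^0$, let $D_v=\{\lambda: d(\lambda)=(1,\dots,1),\ r(\lambda)=v\}$ and $d_v=|D_v|<\infty$. Equip $\mathbb C^{D_v}$ with the inner product $\langle \vec v,\vec w\rangle=\sum_{\lambda\in D_v}\overline{v_\lambda}\,w_\lambda\,\rho(\Lambda)^{(-1,\dots,-1)}x^\Lambda_{s(\lambda)}$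 and let $\{c^{m,v}\}_{m=1}^{d_v-1}$ be an orthonormal basis of the orthogonal complement of $(1,\dots,1)$ in $\mathbb C^{D_v}$ for this inner product. Define $f^{m,v}=\sum_{\lambda\in D_v}c^{m,v}_\lambda\Theta_\lambda$ for $1\le m\le d_v-1$, and $\mathcal W_{0,\Lambda}=\overline{\mathrm{span}}\{f^{m,v}: v\in\Lambda^0,\ 1\le m\le d_v-1\}$. *)

theory Defs
  imports "HOL-Analysis.Analysis"
begin

section \<open>Higher-rank graphs\<close>

text \<open>
  Categories are presented by their morphisms alone: an object is identified with its identity
  morphism, so \<open>src\<close> and \<open>rng\<close> return identity morphisms. The product \<open>cmp \<Lambda> \<mu> \<nu>\<close> (written
  \<open>\<mu>\<nu>\<close> in the literature) is meaningful when \<open>src \<Lambda> \<mu> = rng \<Lambda> \<nu>\<close>. The monoid \<open>\<nat>\<^sup>k\<close> is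
  \<open>nat ^ 'k\<close>, with the componentwise order and \<open>k = CARD('k) \<ge> 1\<close>.
\<close>

record ('a, 'k::finite) kgraph =
  mor :: "'a set"
  rng :: "'a \<Rightarrow> 'a"
  src :: "'a \<Rightarrow> 'a"
  cmp :: "'a \<Rightarrow> 'a \<Rightarrow> 'a"
  deg :: "'a \<Rightarrow> nat ^ 'k"

definition vertices :: "('a, 'k::finite) kgraph \<Rightarrow> 'a set" where
  "vertices \<Lambda> = {v \<in> mor \<Lambda>. rng \<Lambda> v = v \<and> src \<Lambda> v = v}"

locale k_graph =
  fixes \<Lambda> :: "('a, 'k::finite) kgraph"
  assumes countable_mor: "countable (mor \<Lambda>)"
    and rng_vertex: "\<eta> \<in> mor \<Lambda> \<Longrightarrow> rng \<Lambda> \<eta> \<in> vertices \<Lambda>"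
    and src_vertex: "\<eta> \<in> mor \<Lambda> \<Longrightarrow> src \<Lambda> \<eta> \<in> vertices \<Lambda>"
    and cmp_closed: "\<lbrakk>\<mu> \<in> mor \<Lambda>; \<nu> \<in> mor \<Lambda>; src \<Lambda> \<mu> = rng \<Lambda> \<nu>\<rbrakk> \<Longrightarrow> cmp \<Lambda> \<mu> \<nu> \<in> mor \<Lambda>"
    and rng_cmp: "\<lbrakk>\<mu> \<in> mor \<Lambda>; \<nu> \<in> mor \<Lambda>; src \<Lambda> \<mu> = rng \<Lambda> \<nu>\<rbrakk> \<Longrightarrow> rng \<Lambda> (cmp \<Lambda> \<mu> \<nu>) = rng \<Lambda> \<mu>"
    and src_cmp: "\<lbrakk>\<mu> \<in> mor \<Lambda>; \<nu> \<in> mor \<Lambda>; src \<Lambda> \<mu> = rng \<Lambda> \<nu>\<rbrakk> \<Longrightarrow> src \<Lambda> (cmp \<Lambda> \<mu> \<nu>) = src \<Lambda> \<nu>"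
    and cmp_assoc: "\<lbrakk>\<mu> \<in> mor \<Lambda>; \<nu> \<in> mor \<Lambda>; \<tau> \<in> mor \<Lambda>; src \<Lambda> \<mu> = rng \<Lambda> \<nu>; src \<Lambda> \<nu> = rng \<Lambda> \<tau>\<rbrakk>
      \<Longrightarrow> cmp \<Lambda> (cmp \<Lambda> \<mu> \<nu>) \<tau> = cmp \<Lambda> \<mu> (cmp \<Lambda> \<nu> \<tau>)"
    and cmp_rng: "\<eta> \<in> mor \<Lambda> \<Longrightarrow> cmp \<Lambda> (rng \<Lambda> \<eta>) \<eta> = \<eta>"
    and cmp_src: "\<eta> \<in> mor \<Lambda> \<Longrightarrow> cmp \<Lambda> \<eta> (src \<Lambda> \<eta>) = \<eta>"
    and deg_vertex: "v \<in> vertices \<Lambda> \<Longrightarrow> deg \<Lambda> v = 0"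
    and deg_cmp: "\<lbrakk>\<mu> \<in> mor \<Lambda>; \<nu> \<in> mor \<Lambda>; src \<Lambda> \<mu> = rng \<Lambda> \<nu>\<rbrakk>
      \<Longrightarrow> deg \<Lambda> (cmp \<Lambda> \<mu> \<nu>) = deg \<Lambda> \<mu> + deg \<Lambda> \<nu>"
    and factorization: "\<lbrakk>\<eta> \<in> mor \<Lambda>; deg \<Lambda> \<eta> = m + n\<rbrakk>
      \<Longrightarrow> \<exists>!(\<mu>, \<nu>). \<mu> \<in> mor \<Lambda> \<and> \<nu> \<in> mor \<Lambda> \<and> src \<Lambda> \<mu> = rng \<Lambda> \<nu> \<and>
            \<eta> = cmp \<Lambda> \<mu> \<nu> \<and> deg \<Lambda> \<mu> = m \<and> deg \<Lambda> \<nu> = n"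

definition paths_of_degree :: "('a, 'k::finite) kgraph \<Rightarrow> nat ^ 'k \<Rightarrow> 'a set" where
  "paths_of_degree \<Lambda> n = {\<eta> \<in> mor \<Lambda>. deg \<Lambda> \<eta> = n}"

definition paths_between :: "('a, 'k::finite) kgraph \<Rightarrow> 'a \<Rightarrow> 'a \<Rightarrow> 'a set" where
  "paths_between \<Lambda> v w = {\<eta> \<in> mor \<Lambda>. rng \<Lambda> \<eta> = v \<and> src \<Lambda> \<eta> = w}"

definition finite_kgraph :: "('a, 'k::finite) kgraph \<Rightarrow> bool" where
  "finite_kgraph \<Lambda> \<longleftrightarrow> (\<forall>n. finite (paths_of_degree \<Lambda> n))"

definition strongly_connected :: "('a, 'k::finite) kgraph \<Rightarrow> bool" where
  "strongly_connected \<Lambda> \<longleftrightarrow> (\<forall>v \<in> vertices \<Lambda>. \<forall>w \<in> vertices \<Lambda>. paths_between \<Lambda> v w \<noteq> {})"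

definition vertex_matrix :: "('a, 'k::finite) kgraph \<Rightarrow> 'k \<Rightarrow> 'a \<Rightarrow> 'a \<Rightarrow> nat" where
  "vertex_matrix \<Lambda> i v w = card (paths_between \<Lambda> v w \<inter> paths_of_degree \<Lambda> (axis i 1))"

section \<open>Infinite paths\<close>

definition Omega :: "((nat ^ 'k::finite) \<times> (nat ^ 'k), 'k) kgraph" where
  "Omega = \<lparr> mor = {(p, q). p \<le> q},
             rng = (\<lambda>(p, q). (p, p)),
             src = (\<lambda>(p, q). (q, q)),
             cmp = (\<lambda>(p, q) (q', m). (p, m)),
             deg = (\<lambda>(p, q). q - p) \<rparr>"

definition kgraph_morphism :: "('a, 'k::finite) kgraph \<Rightarrow> ('b, 'k::finite) kgraph \<Rightarrow> ('a \<Rightarrow> 'b) \<Rightarrow> bool" where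
  "kgraph_morphism \<Gamma> \<Lambda> F \<longleftrightarrow>
     (\<forall>\<eta> \<in> mor \<Gamma>. F \<eta> \<in> mor \<Lambda> \<and> F (rng \<Gamma> \<eta>) = rng \<Lambda> (F \<eta>) \<and> F (src \<Gamma> \<eta>) = src \<Lambda> (F \<eta>) \<and>
                deg \<Lambda> (F \<eta>) = deg \<Gamma> \<eta>) \<and>
     (\<forall>\<mu> \<in> mor \<Gamma>. \<forall>\<nu> \<in> mor \<Gamma>. src \<Gamma> \<mu> = rng \<Gamma> \<nu> \<longrightarrow> F (cmp \<Gamma> \<mu> \<nu>) = cmp \<Lambda> (F \<mu>) (F \<nu>))"

type_synonym ('a, 'k) inf_path = "(nat ^ 'k) \<times> (nat ^ 'k) \<Rightarrow> 'a"

text \<open>Infinite paths are \<open>undefined\<close> outside \<open>mor Omega\<close>, so that distinct functions are distinct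
  morphisms.\<close>

definition infinite_paths :: "('a, 'k::finite) kgraph \<Rightarrow> ('a, 'k) inf_path set" where
  "infinite_paths \<Lambda> = {x \<in> extensional (mor Omega). kgraph_morphism Omega \<Lambda> x}"

definition cylinder :: "('a, 'k::finite) kgraph \<Rightarrow> 'a \<Rightarrow> ('a, 'k) inf_path set" where
  "cylinder \<Lambda> \<eta> = {x \<in> infinite_paths \<Lambda>. x (0, deg \<Lambda> \<eta>) = \<eta>}"

definition path_topology :: "('a, 'k::finite) kgraph \<Rightarrow> ('a, 'k) inf_path topology" where
  "path_topology \<Lambda> = topology_generated_by (cylinder \<Lambda> ` mor \<Lambda>)"

definition shift :: "nat ^ 'k::finite \<Rightarrow> ('a, 'k) inf_path \<Rightarrow> ('a, 'k) inf_path" where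
  "shift p x = (\<lambda>(m, n) \<in> mor Omega. x (m + p, n + p))"

text \<open>\<open>prefix_map \<Lambda> \<eta>\<close> is \<open>\<sigma>\<^sub>\<eta>\<close>, i.e. \<open>x \<mapsto> \<eta>x\<close>, with domain \<open>cylinder \<Lambda> (src \<Lambda> \<eta>)\<close>.\<close>

definition prefix_map :: "('a, 'k::finite) kgraph \<Rightarrow> 'a \<Rightarrow> ('a, 'k) inf_path \<Rightarrow> ('a, 'k) inf_path" where
  "prefix_map \<Lambda> \<eta> = the_inv_into (cylinder \<Lambda> \<eta>) (shift (deg \<Lambda> \<eta>))"

section \<open>The Perron-Frobenius measure\<close>

text \<open>The spectral radius of a complex matrix with rows and columns indexed by a finite set \<open>I\<close>;
  vectors and matrices are only looked at on \<open>I\<close>.\<close>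

definition spectral_radius_on :: "'v set \<Rightarrow> ('v \<Rightarrow> 'v \<Rightarrow> complex) \<Rightarrow> real" where
  "spectral_radius_on I A =
     Max {cmod z | z. \<exists>u. (\<exists>v \<in> I. u v \<noteq> 0) \<and> (\<forall>v \<in> I. (\<Sum>w \<in> I. A v w * u w) = z * u v)}"

definition rho :: "('a, 'k::finite) kgraph \<Rightarrow> 'k \<Rightarrow> real" where
  "rho \<Lambda> i = spectral_radius_on (vertices \<Lambda>) (\<lambda>v w. of_nat (vertex_matrix \<Lambda> i v w))"

definition rho_pow :: "('a, 'k::finite) kgraph \<Rightarrow> nat ^ 'k \<Rightarrow> real" where
  "rho_pow \<Lambda> n = (\<Prod>i \<in> UNIV. rho \<Lambda> i ^ (n $ i))"

definition pf_vector :: "('a, 'k::finite) kgraph \<Rightarrow> ('a \<Rightarrow> real) \<Rightarrow> bool" where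
  "pf_vector \<Lambda> xL \<longleftrightarrow>
     (\<forall>v \<in> vertices \<Lambda>. xL v > 0) \<and>
     (\<Sum>v \<in> vertices \<Lambda>. \<bar>xL v\<bar>) = 1 \<and>
     (\<forall>i. \<forall>v \<in> vertices \<Lambda>.
        (\<Sum>w \<in> vertices \<Lambda>. real (vertex_matrix \<Lambda> i v w) * xL w) = rho \<Lambda> i * xL v)"

definition pf_measure ::
  "('a, 'k::finite) kgraph \<Rightarrow> ('a \<Rightarrow> real) \<Rightarrow> ('a, 'k) inf_path measure \<Rightarrow> bool" where
  "pf_measure \<Lambda> xL M \<longleftrightarrow>
     space M = infinite_paths \<Lambda> \<and>
     sets M = sigma_sets (infinite_paths \<Lambda>) {U. openin (path_topology \<Lambda>) U} \<and>
     emeasure M (space M) = 1 \<and>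
     (\<forall>\<eta> \<in> mor \<Lambda>. measure M (cylinder \<Lambda> \<eta>) = inverse (rho_pow \<Lambda> (deg \<Lambda> \<eta>)) * xL (src \<Lambda> \<eta>))"

section \<open>Square-integrable functions\<close>

text \<open>
  Elements of \<open>L\<^sup>2(M)\<close> are represented by functions. No quotient is taken; instead, all the sets of
  functions below that stand for subsets of \<open>L\<^sup>2(M)\<close> defined by closure, including \<open>L2 M\<close> itself,
  contain with a function every measurable function equal to it almost everywhere. Equality
  of two such sets is therefore equality of the corresponding sets of classes.
\<close>

definition L2 :: "'x measure \<Rightarrow> ('x \<Rightarrow> complex) set" where
  "L2 M = {f \<in> borel_measurable M. integrable M (\<lambda>x. (cmod (f x))\<^sup>2)}"

definition L2_inner :: "'x measure \<Rightarrow> ('x \<Rightarrow> complex) \<Rightarrow> ('x \<Rightarrow> complex) \<Rightarrow> complex" where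
  "L2_inner M f g = (\<integral>x. f x * cnj (g x) \<partial>M)"

definition L2_norm :: "'x measure \<Rightarrow> ('x \<Rightarrow> complex) \<Rightarrow> real" where
  "L2_norm M f = sqrt (\<integral>x. (cmod (f x))\<^sup>2 \<partial>M)"

definition lin_span :: "('x \<Rightarrow> complex) set \<Rightarrow> ('x \<Rightarrow> complex) set" where
  "lin_span B = {(\<lambda>x. \<Sum>b \<in> F. a b * b x) | F a. finite F \<and> F \<subseteq> B}"

definition closed_span :: "'x measure \<Rightarrow> ('x \<Rightarrow> complex) set \<Rightarrow> ('x \<Rightarrow> complex) set" where
  "closed_span M B = {f \<in> L2 M. \<forall>\<epsilon> > 0. \<exists>g \<in> lin_span B. L2_norm M (\<lambda>x. f x - g x) < \<epsilon>}"

definition orthonormal_family :: "'x measure \<Rightarrow> 'i set \<Rightarrow> ('i \<Rightarrow> 'x \<Rightarrow> complex) \<Rightarrow> bool" where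
  "orthonormal_family M I e \<longleftrightarrow>
     (\<forall>i \<in> I. e i \<in> L2 M) \<and>
     (\<forall>i \<in> I. \<forall>j \<in> I. L2_inner M (e i) (e j) = (if i = j then 1 else 0))"

text \<open>\<open>orthogonal_direct_sum M H I E\<close>: \<open>H\<close> is the internal Hilbert space direct sum of the closed
  subspaces \<open>E i\<close>, \<open>i \<in> I\<close>. The condition \<open>closed_span M (E i) = E i\<close> says that \<open>E i\<close> is a closed
  linear subspace of \<open>L\<^sup>2(M)\<close>.\<close>

definition orthogonal_direct_sum ::
  "'x measure \<Rightarrow> ('x \<Rightarrow> complex) set \<Rightarrow> 'i set \<Rightarrow> ('i \<Rightarrow> ('x \<Rightarrow> complex) set) \<Rightarrow> bool" where
  "orthogonal_direct_sum M H I E \<longleftrightarrow>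
     (\<forall>i \<in> I. E i \<subseteq> L2 M \<and> closed_span M (E i) = E i) \<and>
     (\<forall>i \<in> I. \<forall>j \<in> I. i \<noteq> j \<longrightarrow> (\<forall>f \<in> E i. \<forall>g \<in> E j. L2_inner M f g = 0)) \<and>
     H = closed_span M (\<Union>i \<in> I. E i)"

section \<open>The operators and the wavelets\<close>

text \<open>\<open>pulled_back_measure \<Lambda> M \<eta>\<close> is \<open>M \<circ> \<sigma>\<^sub>\<eta>\<close>, and \<open>RN_prefix \<Lambda> M \<eta>\<close> is
  \<open>\<Phi> = d(M \<circ> \<sigma>\<^sub>\<eta>)/dM\<close>, both on \<open>cylinder \<Lambda> (src \<Lambda> \<eta>)\<close>.\<close>

definition pulled_back_measure ::
  "('a, 'k::finite) kgraph \<Rightarrow> ('a, 'k) inf_path measure \<Rightarrow> 'a \<Rightarrow> ('a, 'k) inf_path measure" where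
  "pulled_back_measure \<Lambda> M \<eta> =
     (let Z = cylinder \<Lambda> (src \<Lambda> \<eta>)
      in measure_of Z (sets (restrict_space M Z)) (\<lambda>A. emeasure M (prefix_map \<Lambda> \<eta> ` A)))"

definition RN_prefix ::
  "('a, 'k::finite) kgraph \<Rightarrow> ('a, 'k) inf_path measure \<Rightarrow> 'a \<Rightarrow> ('a, 'k) inf_path \<Rightarrow> real" where
  "RN_prefix \<Lambda> M \<eta> x =
     enn2real (RN_deriv (restrict_space M (cylinder \<Lambda> (src \<Lambda> \<eta>))) (pulled_back_measure \<Lambda> M \<eta>) x)"

definition S_op ::
  "('a, 'k::finite) kgraph \<Rightarrow> ('a, 'k) inf_path measure \<Rightarrow> 'a \<Rightarrow>
   (('a, 'k) inf_path \<Rightarrow> complex) \<Rightarrow> ('a, 'k) inf_path \<Rightarrow> complex" where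
  "S_op \<Lambda> M \<eta> \<xi> x =
     indicator (cylinder \<Lambda> \<eta>) x *
     complex_of_real (RN_prefix \<Lambda> M \<eta> (shift (deg \<Lambda> \<eta>) x) powr (- 1 / 2)) *
     \<xi> (shift (deg \<Lambda> \<eta>) x)"

definition Theta :: "('a, 'k::finite) kgraph \<Rightarrow> 'a \<Rightarrow> ('a, 'k) inf_path \<Rightarrow> complex" where
  "Theta \<Lambda> \<eta> = indicator (cylinder \<Lambda> \<eta>)"

text \<open>The degree \<open>(n, \<dots>, n)\<close>.\<close>

definition diag :: "nat \<Rightarrow> nat ^ 'k::finite" where
  "diag n = (\<chi> i. n)"

definition diag_cylinder_functions ::
  "('a, 'k::finite) kgraph \<Rightarrow> (('a, 'k) inf_path \<Rightarrow> complex) set" where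
  "diag_cylinder_functions \<Lambda> = {Theta \<Lambda> \<eta> | \<eta>. \<eta> \<in> mor \<Lambda> \<and> (\<exists>n. deg \<Lambda> \<eta> = diag n)}"

definition V0 ::
  "('a, 'k::finite) kgraph \<Rightarrow> ('a \<Rightarrow> real) \<Rightarrow> ('a, 'k) inf_path measure \<Rightarrow>
   (('a, 'k) inf_path \<Rightarrow> complex) set" where
  "V0 \<Lambda> xL M =
     closed_span M {(\<lambda>x. complex_of_real (1 / sqrt (xL v)) * Theta \<Lambda> v x) | v. v \<in> vertices \<Lambda>}"

definition D_paths :: "('a, 'k::finite) kgraph \<Rightarrow> 'a \<Rightarrow> 'a set" where
  "D_paths \<Lambda> v = {\<eta> \<in> mor \<Lambda>. deg \<Lambda> \<eta> = diag 1 \<and> rng \<Lambda> \<eta> = v}"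

definition D_inner ::
  "('a, 'k::finite) kgraph \<Rightarrow> ('a \<Rightarrow> real) \<Rightarrow> 'a \<Rightarrow> ('a \<Rightarrow> complex) \<Rightarrow> ('a \<Rightarrow> complex) \<Rightarrow> complex" where
  "D_inner \<Lambda> xL v a b =
     (\<Sum>\<eta> \<in> D_paths \<Lambda> v. cnj (a \<eta>) * b \<eta> * complex_of_real (inverse (rho_pow \<Lambda> (diag 1)) * xL (src \<Lambda> \<eta>)))"

definition wavelet_indices :: "('a, 'k::finite) kgraph \<Rightarrow> 'a \<Rightarrow> nat set" where
  "wavelet_indices \<Lambda> v = {1..card (D_paths \<Lambda> v) - 1}"

text \<open>\<open>wavelet_coeffs \<Lambda> xL c\<close>: for every vertex \<open>v\<close>, the vectors \<open>c m v\<close> (\<open>m\<close> in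
  \<open>wavelet_indices \<Lambda> v\<close>) form an orthonormal basis of the orthogonal complement of \<open>(1, \<dots>, 1)\<close> in
  \<open>\<complex>\<^bsup>D_paths \<Lambda> v\<^esup>\<close>. Vectors are functions on all of \<open>'a\<close> of which only the values on \<open>D_paths \<Lambda> v\<close> matter.\<close>

definition wavelet_coeffs ::
  "('a, 'k::finite) kgraph \<Rightarrow> ('a \<Rightarrow> real) \<Rightarrow> (nat \<Rightarrow> 'a \<Rightarrow> 'a \<Rightarrow> complex) \<Rightarrow> bool" where
  "wavelet_coeffs \<Lambda> xL c \<longleftrightarrow>
     (\<forall>v \<in> vertices \<Lambda>.
        (\<forall>m \<in> wavelet_indices \<Lambda> v. D_inner \<Lambda> xL v (\<lambda>_. 1) (c m v) = 0) \<and>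
        (\<forall>m \<in> wavelet_indices \<Lambda> v. \<forall>m' \<in> wavelet_indices \<Lambda> v.
           D_inner \<Lambda> xL v (c m v) (c m' v) = (if m = m' then 1 else 0)) \<and>
        (\<forall>u. D_inner \<Lambda> xL v (\<lambda>_. 1) u = 0 \<longrightarrow>
           (\<exists>a. \<forall>\<eta> \<in> D_paths \<Lambda> v. u \<eta> = (\<Sum>m \<in> wavelet_indices \<Lambda> v. a m * c m v \<eta>))))"

definition wavelet ::
  "('a, 'k::finite) kgraph \<Rightarrow> (nat \<Rightarrow> 'a \<Rightarrow> 'a \<Rightarrow> complex) \<Rightarrow> nat \<Rightarrow> 'a \<Rightarrow>
   ('a, 'k) inf_path \<Rightarrow> complex" where
  "wavelet \<Lambda> c m v x = (\<Sum>\<eta> \<in> D_paths \<Lambda> v. c m v \<eta> * Theta \<Lambda> \<eta> x)"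

definition C_paths :: "('a, 'k::finite) kgraph \<Rightarrow> nat \<Rightarrow> 'a \<Rightarrow> 'a set" where
  "C_paths \<Lambda> j v = {\<eta> \<in> mor \<Lambda>. src \<Lambda> \<eta> = v \<and> deg \<Lambda> \<eta> = diag j}"

definition W ::
  "('a, 'k::finite) kgraph \<Rightarrow> (nat \<Rightarrow> 'a \<Rightarrow> 'a \<Rightarrow> complex) \<Rightarrow> ('a, 'k) inf_path measure \<Rightarrow>
   nat \<Rightarrow> (('a, 'k) inf_path \<Rightarrow> complex) set" where
  "W \<Lambda> c M j =
     (if j = 0
      then closed_span M {wavelet \<Lambda> c m v | m v. v \<in> vertices \<Lambda> \<and> m \<in> wavelet_indices \<Lambda> v}
      else closed_span M {S_op \<Lambda> M \<eta> (wavelet \<Lambda> c m v) | \<eta> m v.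
             v \<in> vertices \<Lambda> \<and> \<eta> \<in> C_paths \<Lambda> j v \<and> m \<in> wavelet_indices \<Lambda> v})"

end

theory Submission
  imports Defs
begin

text \<open>
  The measure of \<open>Z(\<lambda>)\<close> makes \<open>M \<circ> \<sigma>\<^sub>\<lambda>\<close> a constant multiple of \<open>M\<close> on \<open>Z(s(\<lambda>))\<close>, so up to a null set
  \<open>S\<^sub>\<lambda> f\<^sup>m\<^sup>,\<^sup>v\<close> is \<open>\<rho>(\<Lambda>)\<close> to the power \<open>d(\<lambda>)/2\<close> times the combination of the \<open>\<Theta>\<^bsub>\<lambda>\<mu>\<^esub>\<close>, \<open>\<mu> \<in> D\<^sub>v\<close>, with coefficients
  \<open>c\<^sup>m\<^sup>,\<^sup>v\<close>. Such a function lives on \<open>Z(\<lambda>)\<close> and has integral zero, whereas the functions of a lower level,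
  and those of the same level for a path other than \<open>\<lambda>\<close>, are constant on \<open>Z(\<lambda>)\<close>; this gives all
  orthogonality relations. Conversely, the indicator of a single \<open>\<mu> \<in> D\<^sub>v\<close> is a combination of the
  constant vector and of the \<open>c\<^sup>m\<^sup>,\<^sup>v\<close>, so by induction on the degree every \<open>\<Theta>\<^sub>\<lambda>\<close> with \<open>d(\<lambda>)\<close> diagonal is
  in the span. The diagonal cylinder sets are stable under intersection (up to the empty set) and
  generate the Borel sets, so their indicators span a dense subspace of \<open>L\<^sup>2\<close>.
\<close>

section \<open>Closed spans in \<open>L\<^sup>2\<close>\<close>

text \<open>For k at least 2 the order on degrees is only partial, and two cylinder sets can overlap
  without either containing the other. The degrees (n, ..., n) form a chain, which restores the
  alternative "nested or disjoint", and they are cofinal, so no open set is lost. The exponent d/2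
  is a normalization: passing from Z(\<mu>) to Z(\<lambda>\<mu>) multiplies the measure by rho to
  the power -d(\<lambda>), the same factor for every \<mu>, because the mass depends only on the
  degree and the source. The weights of the inner product on the coefficient vectors at v are the
  measures of Z(l), l in D_v. Orthonormality of these vectors therefore carries over to every path
  \<lambda> with source v. The Radon-Nikodym derivative is determined only up to a null set and is
  evaluated at a shifted point, so null sets have to be pulled back along the shift. Hence
  computations use explicit representatives, and the operators enter only through equality almost
  everywhere.\<close>

lemma borel_measurable_cnj [measurable]: "cnj \<in> borel_measurable borel"
  by (intro borel_measurable_continuous_onI continuous_intros)

lemma L2_meas: "f \<in> L2 M \<Longrightarrow> f \<in> borel_measurable M"
  by (simp add: L2_def)

lemma L2_norm_integrable: "f \<in> L2 M \<Longrightarrow> integrable M (\<lambda>x. (cmod (f x))\<^sup>2)"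
  by (simp add: L2_def)

lemma L2_cong_AE:
  assumes "f \<in> L2 M" "g \<in> borel_measurable M" "AE x in M. f x = g x"
  shows "g \<in> L2 M"
proof -
  have [measurable]: "g \<in> borel_measurable M" "f \<in> borel_measurable M"
    using assms L2_meas by auto
  have "AE x in M. (cmod (g x))\<^sup>2 = (cmod (f x))\<^sup>2"
    using assms(3) by eventually_elim simp
  then have "integrable M (\<lambda>x. (cmod (g x))\<^sup>2) = integrable M (\<lambda>x. (cmod (f x))\<^sup>2)"
    by (intro integrable_cong_AE) measurable
  then show ?thesis
    using assms by (simp add: L2_def)
qed

lemma L2_integrable_mult:
  assumes "f \<in> L2 M" "g \<in> L2 M"
  shows "integrable M (\<lambda>x. f x * cnj (g x))" "integrable M (\<lambda>x. cmod (f x) * cmod (g x))"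
proof -
  have [measurable]: "f \<in> borel_measurable M" "g \<in> borel_measurable M"
    using assms L2_meas by auto
  have i: "integrable M (\<lambda>x. (cmod (f x))\<^sup>2 + (cmod (g x))\<^sup>2)"
    using assms by (intro Bochner_Integration.integrable_add L2_norm_integrable)
  have le: "cmod (f x) * cmod (g x) \<le> (cmod (f x))\<^sup>2 + (cmod (g x))\<^sup>2" for x
  proof -
    have "2 * (cmod (f x) * cmod (g x)) \<le> (cmod (f x))\<^sup>2 + (cmod (g x))\<^sup>2"
      using sum_squares_bound[of "cmod (f x)" "cmod (g x)"] by (simp add: mult.assoc)
    moreover have "0 \<le> cmod (f x) * cmod (g x)"
      by simp
    ultimately show ?thesis
      by linarith
  qed
  show "integrable M (\<lambda>x. f x * cnj (g x))"
    by (rule Bochner_Integration.integrable_bound[OF i]) (use le in \<open>auto simp: norm_mult\<close>)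
  show "integrable M (\<lambda>x. cmod (f x) * cmod (g x))"
    by (rule Bochner_Integration.integrable_bound[OF i]) (use le in auto)
qed

lemma L2_add:
  assumes "f \<in> L2 M" "g \<in> L2 M"
  shows "(\<lambda>x. f x + g x) \<in> L2 M"
proof -
  have [measurable]: "f \<in> borel_measurable M" "g \<in> borel_measurable M"
    using assms L2_meas by auto
  have i: "integrable M (\<lambda>x. (cmod (f x))\<^sup>2 + 2 * (cmod (f x) * cmod (g x)) + (cmod (g x))\<^sup>2)"
    using assms by (intro Bochner_Integration.integrable_add L2_norm_integrable
        Bochner_Integration.integrable_mult_right L2_integrable_mult) auto
  have le: "(cmod (f x + g x))\<^sup>2 \<le> (cmod (f x))\<^sup>2 + 2 * (cmod (f x) * cmod (g x)) + (cmod (g x))\<^sup>2" for x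
    using power_mono[OF norm_triangle_ineq[of "f x" "g x"], of 2]
    by (simp add: power2_sum algebra_simps)
  have "integrable M (\<lambda>x. (cmod (f x + g x))\<^sup>2)"
    by (rule Bochner_Integration.integrable_bound[OF i]) (use le in auto)
  then show ?thesis
    by (simp add: L2_def)
qed

lemma L2_cmult:
  assumes "f \<in> L2 M"
  shows "(\<lambda>x. a * f x) \<in> L2 M"
  using assms by (auto simp: L2_def norm_mult power_mult_distrib)

lemma L2_zero: "(\<lambda>_. 0) \<in> L2 M"
  by (simp add: L2_def)

lemma L2_diff: "f \<in> L2 M \<Longrightarrow> g \<in> L2 M \<Longrightarrow> (\<lambda>x. f x - g x) \<in> L2 M"
  using L2_add[of f M "\<lambda>x. (- 1) * g x"] L2_cmult[of g M "- 1"] by simp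

lemma L2_sum: "(\<And>i. i \<in> I \<Longrightarrow> f i \<in> L2 M) \<Longrightarrow> (\<lambda>x. \<Sum>i\<in>I. f i x) \<in> L2 M"
  by (induction I rule: infinite_finite_induct) (auto intro: L2_zero L2_add)

lemma L2_bounded:
  assumes "finite_measure M" "f \<in> borel_measurable M" "\<And>x. x \<in> space M \<Longrightarrow> cmod (f x) \<le> B"
  shows "f \<in> L2 M"
proof -
  have "integrable M (\<lambda>x. (cmod (f x))\<^sup>2)"
    by (rule finite_measure.integrable_const_bound[OF assms(1), where B = "B\<^sup>2"])
      (use assms(2,3) in \<open>auto intro!: power_mono\<close>)
  then show ?thesis
    using assms(2) by (simp add: L2_def)
qed

lemma L2_norm_nonneg: "0 \<le> L2_norm M f"
  by (simp add: L2_norm_def)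

lemma L2_norm_square: "(L2_norm M f)\<^sup>2 = (\<integral>x. (cmod (f x))\<^sup>2 \<partial>M)"
  by (simp add: L2_norm_def)

text \<open>Nonnegativity of the integral of (t|f| - |g|)^2 for every real t is a quadratic
  inequality in t, and the best choice of t yields the bound. Working with moduli lets one estimate
  serve both the Cauchy-Schwarz inequality for \<open>L2_inner\<close> and the triangle
  inequality.\<close>

lemma integral_norm_mult_le:
  assumes f: "f \<in> L2 M" and g: "g \<in> L2 M"
  shows "(\<integral>x. cmod (f x) * cmod (g x) \<partial>M) \<le> L2_norm M f * L2_norm M g"
proof -
  define a where "a = (\<integral>x. (cmod (f x))\<^sup>2 \<partial>M)"
  define b where "b = (\<integral>x. cmod (f x) * cmod (g x) \<partial>M)"
  define d where "d = (\<integral>x. (cmod (g x))\<^sup>2 \<partial>M)"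
  have a0: "0 \<le> a" and b0: "0 \<le> b" and d0: "0 \<le> d"
    by (auto simp: a_def b_def d_def)
  have q: "2 * t * b \<le> t\<^sup>2 * a + d" for t
  proof -
    have "2 * t * b = (\<integral>x. 2 * t * (cmod (f x) * cmod (g x)) \<partial>M)"
      by (simp add: b_def)
    also have "\<dots> \<le> (\<integral>x. t\<^sup>2 * (cmod (f x))\<^sup>2 + (cmod (g x))\<^sup>2 \<partial>M)"
    proof (rule integral_mono)
      fix x
      show "2 * t * (cmod (f x) * cmod (g x)) \<le> t\<^sup>2 * (cmod (f x))\<^sup>2 + (cmod (g x))\<^sup>2"
        using sum_squares_bound[of "t * cmod (f x)" "cmod (g x)"]
        by (simp add: power_mult_distrib algebra_simps)
    qed (auto intro!: L2_norm_integrable L2_integrable_mult f g)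
    also have "\<dots> = t\<^sup>2 * a + d"
      by (subst Bochner_Integration.integral_add)
        (auto intro!: L2_norm_integrable f g simp: a_def d_def)
    finally show ?thesis .
  qed
  have "b\<^sup>2 \<le> a * d"
  proof (cases "a = 0")
    case True
    have "b = 0"
    proof (rule ccontr)
      assume "b \<noteq> 0"
      with b0 have "b > 0" by simp
      \<comment> \<open>With a = 0 the inequality degenerates to 2 t b \<le> d for all t; the chosen
        t makes its left side d + 1.\<close>
      then show False
        using q[of "(d + 1) / (2 * b)"] True by (simp add: field_simps)
    qed
    then show ?thesis using True by simp
  next
    case False
    then have "a > 0" using a0 by simp
    \<comment> \<open>The value t = b / a minimizes t^2 a - 2 t b + d.\<close>
    have "2 * (b / a) * b \<le> (b / a)\<^sup>2 * a + d"
      by (rule q)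
    then show ?thesis
      using \<open>a > 0\<close> by (simp add: field_simps power2_eq_square)
  qed
  then have "b \<le> sqrt (a * d)"
    by (rule real_le_rsqrt)
  then show ?thesis
    by (simp add: a_def b_def d_def L2_norm_def real_sqrt_mult)
qed

lemma L2_Cauchy_Schwarz:
  assumes f: "f \<in> L2 M" and g: "g \<in> L2 M"
  shows "cmod (L2_inner M f g) \<le> L2_norm M f * L2_norm M g"
proof -
  have "cmod (L2_inner M f g) \<le> (\<integral>x. cmod (f x * cnj (g x)) \<partial>M)"
    unfolding L2_inner_def by (rule integral_norm_bound)
  also have "\<dots> = (\<integral>x. cmod (f x) * cmod (g x) \<partial>M)"
    by (simp add: norm_mult)
  also have "\<dots> \<le> L2_norm M f * L2_norm M g"
    by (rule integral_norm_mult_le[OF f g])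
  finally show ?thesis .
qed

lemma L2_norm_triangle:
  assumes f: "f \<in> L2 M" and g: "g \<in> L2 M"
  shows "L2_norm M (\<lambda>x. f x + g x) \<le> L2_norm M f + L2_norm M g"
proof (rule power2_le_imp_le)
  have "(L2_norm M (\<lambda>x. f x + g x))\<^sup>2 = (\<integral>x. (cmod (f x + g x))\<^sup>2 \<partial>M)"
    by (rule L2_norm_square)
  also have "\<dots> \<le> (\<integral>x. (cmod (f x))\<^sup>2 + 2 * (cmod (f x) * cmod (g x)) + (cmod (g x))\<^sup>2 \<partial>M)"
  proof (rule integral_mono)
    fix x
    show "(cmod (f x + g x))\<^sup>2 \<le> (cmod (f x))\<^sup>2 + 2 * (cmod (f x) * cmod (g x)) + (cmod (g x))\<^sup>2"
      using power_mono[OF norm_triangle_ineq[of "f x" "g x"], of 2]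
      by (simp add: power2_sum algebra_simps)
  qed (intro Bochner_Integration.integrable_add Bochner_Integration.integrable_mult_right
      L2_norm_integrable L2_integrable_mult L2_add f g)+
  also have "\<dots> = (L2_norm M f)\<^sup>2 + 2 * (\<integral>x. cmod (f x) * cmod (g x) \<partial>M) + (L2_norm M g)\<^sup>2"
    using L2_norm_integrable[OF f] L2_norm_integrable[OF g] L2_integrable_mult(2)[OF f g]
    by (simp add: L2_norm_square)
  also have "\<dots> \<le> (L2_norm M f + L2_norm M g)\<^sup>2"
    using integral_norm_mult_le[OF f g] by (simp add: power2_sum)
  finally show "(L2_norm M (\<lambda>x. f x + g x))\<^sup>2 \<le> (L2_norm M f + L2_norm M g)\<^sup>2" .
qed (simp add: L2_norm_nonneg)

lemma L2_norm_cmult: "L2_norm M (\<lambda>x. a * f x) = cmod a * L2_norm M f"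
  by (simp add: L2_norm_def norm_mult power_mult_distrib real_sqrt_mult)

lemma L2_norm_cong_AE:
  assumes [measurable]: "f \<in> borel_measurable M" "g \<in> borel_measurable M"
    and "AE x in M. f x = g x"
  shows "L2_norm M f = L2_norm M g"
proof -
  have "(\<integral>x. (cmod (f x))\<^sup>2 \<partial>M) = (\<integral>x. (cmod (g x))\<^sup>2 \<partial>M)"
  proof (rule integral_cong_AE)
    show "AE x in M. (cmod (f x))\<^sup>2 = (cmod (g x))\<^sup>2"
      using assms(3) by eventually_elim simp
  qed measurable
  then show ?thesis
    by (simp add: L2_norm_def)
qed

lemma L2_inner_cnj: "L2_inner M g f = cnj (L2_inner M f g)"
proof -
  have "cnj (L2_inner M f g) = (\<integral>x. cnj (f x * cnj (g x)) \<partial>M)"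
    unfolding L2_inner_def by (rule Bochner_Integration.integral_cnj[symmetric])
  then show ?thesis
    by (simp add: L2_inner_def mult.commute)
qed

lemma L2_inner_cong_AE:
  assumes [measurable]: "f \<in> borel_measurable M" "g \<in> borel_measurable M"
    "f' \<in> borel_measurable M" "g' \<in> borel_measurable M"
    and "AE x in M. f x = f' x" "AE x in M. g x = g' x"
  shows "L2_inner M f g = L2_inner M f' g'"
  unfolding L2_inner_def
proof (rule integral_cong_AE)
  show "AE x in M. f x * cnj (g x) = f' x * cnj (g' x)"
    using assms(5,6) by eventually_elim simp
qed measurable

section \<open>Linear spans and closed linear spans\<close>

lemma lin_span_base: "b \<in> B \<Longrightarrow> b \<in> lin_span B"
  unfolding lin_span_def by (intro CollectI exI[of _ "{b}"] exI[of _ "\<lambda>_. 1"]) auto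

lemma lin_span_zero: "(\<lambda>_. 0) \<in> lin_span B"
  unfolding lin_span_def by (intro CollectI exI[of _ "{}"]) auto

lemma lin_span_add:
  assumes "f \<in> lin_span B" "g \<in> lin_span B"
  shows "(\<lambda>x. f x + g x) \<in> lin_span B"
proof -
  obtain F a where f: "f = (\<lambda>x. \<Sum>b\<in>F. a b * b x)" "finite F" "F \<subseteq> B"
    using assms(1) unfolding lin_span_def by blast
  obtain G a' where g: "g = (\<lambda>x. \<Sum>b\<in>G. a' b * b x)" "finite G" "G \<subseteq> B"
    using assms(2) unfolding lin_span_def by blast
  let ?c = "\<lambda>b. (if b \<in> F then a b else 0) + (if b \<in> G then a' b else 0)"
  have "(\<Sum>b\<in>F \<union> G. ?c b * b x) = f x + g x" for x
  proof -
    have "(\<Sum>b\<in>F \<union> G. ?c b * b x) =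
        (\<Sum>b\<in>F \<union> G. (if b \<in> F then a b else 0) * b x) + (\<Sum>b\<in>F \<union> G. (if b \<in> G then a' b else 0) * b x)"
      by (simp add: distrib_right sum.distrib)
    also have "(\<Sum>b\<in>F \<union> G. (if b \<in> F then a b else 0) * b x) = f x"
      unfolding f(1) by (rule sum.mono_neutral_cong_right) (use f g in auto)
    also have "(\<Sum>b\<in>F \<union> G. (if b \<in> G then a' b else 0) * b x) = g x"
      unfolding g(1) by (rule sum.mono_neutral_cong_right) (use f g in auto)
    finally show ?thesis .
  qed
  then show ?thesis
    unfolding lin_span_def using f(2,3) g(2,3)
    by (intro CollectI exI[of _ "F \<union> G"] exI[of _ ?c]) auto
qed

lemma lin_span_cmult:
  assumes "f \<in> lin_span B"
  shows "(\<lambda>x. a * f x) \<in> lin_span B"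
proof -
  obtain F a' where f: "f = (\<lambda>x. \<Sum>b\<in>F. a' b * b x)" "finite F" "F \<subseteq> B"
    using assms(1) unfolding lin_span_def by blast
  have "(\<lambda>x. a * f x) = (\<lambda>x. \<Sum>b\<in>F. (a * a' b) * b x)"
    by (simp add: f sum_distrib_left mult.assoc)
  then show ?thesis
    unfolding lin_span_def using f by (intro CollectI exI[of _ F] exI[of _ "\<lambda>b. a * a' b"]) auto
qed

lemma lin_span_L2:
  assumes "B \<subseteq> L2 M" "f \<in> lin_span B"
  shows "f \<in> L2 M"
  using assms unfolding lin_span_def by (auto intro!: L2_sum L2_cmult)

lemma closed_span_L2: "closed_span M B \<subseteq> L2 M"
  by (auto simp: closed_span_def)

lemma closed_span_D:
  assumes "f \<in> closed_span M B" "0 < \<epsilon>"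
  obtains g where "g \<in> lin_span B" "L2_norm M (\<lambda>x. f x - g x) < \<epsilon>"
  using assms unfolding closed_span_def by blast

lemma lin_span_subset_closed_span:
  assumes "B \<subseteq> L2 M"
  shows "lin_span B \<subseteq> closed_span M B"
proof
  fix f assume f: "f \<in> lin_span B"
  have "\<exists>g\<in>lin_span B. L2_norm M (\<lambda>x. f x - g x) < \<epsilon>" if "\<epsilon> > 0" for \<epsilon>
    using f that by (intro bexI[of _ f]) (auto simp: L2_norm_def)
  then show "f \<in> closed_span M B"
    using lin_span_L2[OF assms f] by (simp add: closed_span_def)
qed

lemma closed_span_base: "B \<subseteq> L2 M \<Longrightarrow> b \<in> B \<Longrightarrow> b \<in> closed_span M B"
  using lin_span_subset_closed_span lin_span_base by blast

lemma closed_span_zero: "(\<lambda>_. 0) \<in> closed_span M B"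
proof -
  have "\<exists>g\<in>lin_span B. L2_norm M (\<lambda>x. 0 - g x) < \<epsilon>" if "\<epsilon> > 0" for \<epsilon>
    using that by (intro bexI[OF _ lin_span_zero]) (auto simp: L2_norm_def)
  then show ?thesis
    by (simp add: closed_span_def L2_zero)
qed

text \<open>Approximation errors in norm do not see null sets. As elements of L^2 are functions and
  not classes, this is the means of exchanging one representative for another, in particular an
  operator applied to a wavelet for its explicit form.\<close>

lemma closed_span_cong_AE:
  assumes B: "B \<subseteq> L2 M" and f: "f \<in> closed_span M B"
    and g: "g \<in> borel_measurable M" "AE x in M. f x = g x"
  shows "g \<in> closed_span M B"
proof -
  have fL: "f \<in> L2 M"
    using f closed_span_L2 by blast
  have "\<exists>h\<in>lin_span B. L2_norm M (\<lambda>x. g x - h x) < \<epsilon>" if \<epsilon>: "\<epsilon> > 0" for \<epsilon>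
  proof -
    obtain h where h: "h \<in> lin_span B" "L2_norm M (\<lambda>x. f x - h x) < \<epsilon>"
      using closed_span_D[OF f \<epsilon>] .
    have "L2_norm M (\<lambda>x. g x - h x) = L2_norm M (\<lambda>x. f x - h x)"
    proof (rule L2_norm_cong_AE)
      show "AE x in M. g x - h x = f x - h x"
        using g(2) by eventually_elim simp
    qed (use L2_meas[OF lin_span_L2[OF B h(1)]] L2_meas[OF fL] g(1) in \<open>auto intro: borel_measurable_diff\<close>)
    with h show ?thesis by (intro bexI[of _ h]) auto
  qed
  then show ?thesis
    using L2_cong_AE[OF fL g] by (simp add: closed_span_def)
qed

lemma closed_span_add:
  assumes B: "B \<subseteq> L2 M" and f: "f \<in> closed_span M B" and g: "g \<in> closed_span M B"
  shows "(\<lambda>x. f x + g x) \<in> closed_span M B"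
proof -
  have fL: "f \<in> L2 M" and gL: "g \<in> L2 M"
    using f g closed_span_L2 by blast+
  have "\<exists>h\<in>lin_span B. L2_norm M (\<lambda>x. (f x + g x) - h x) < \<epsilon>" if \<epsilon>: "\<epsilon> > 0" for \<epsilon>
  proof -
    obtain f' where f': "f' \<in> lin_span B" "L2_norm M (\<lambda>x. f x - f' x) < \<epsilon> / 2"
      using closed_span_D[OF f, of "\<epsilon> / 2"] \<epsilon> by auto
    obtain g' where g': "g' \<in> lin_span B" "L2_norm M (\<lambda>x. g x - g' x) < \<epsilon> / 2"
      using closed_span_D[OF g, of "\<epsilon> / 2"] \<epsilon> by auto
    have "L2_norm M (\<lambda>x. (f x - f' x) + (g x - g' x)) \<le> L2_norm M (\<lambda>x. f x - f' x) + L2_norm M (\<lambda>x. g x - g' x)"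
      by (intro L2_norm_triangle L2_diff fL gL lin_span_L2[OF B] f' g')
    then have "L2_norm M (\<lambda>x. (f x + g x) - (f' x + g' x)) < \<epsilon>"
      using f'(2) g'(2) by (simp add: algebra_simps)
    then show ?thesis
      by (intro bexI[OF _ lin_span_add[OF f'(1) g'(1)]])
  qed
  then show ?thesis
    using L2_add[OF fL gL] by (simp add: closed_span_def)
qed

lemma closed_span_cmult:
  assumes f: "f \<in> closed_span M B"
  shows "(\<lambda>x. a * f x) \<in> closed_span M B"
proof (cases "a = 0")
  case True
  then show ?thesis by (simp add: closed_span_zero)
next
  case False
  have fL: "f \<in> L2 M"
    using f closed_span_L2 by blast
  have "\<exists>h\<in>lin_span B. L2_norm M (\<lambda>x. a * f x - h x) < \<epsilon>" if \<epsilon>: "\<epsilon> > 0" for \<epsilon>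
  proof -
    obtain f' where f': "f' \<in> lin_span B" "L2_norm M (\<lambda>x. f x - f' x) < \<epsilon> / cmod a"
      using closed_span_D[OF f, of "\<epsilon> / cmod a"] \<epsilon> False by auto
    have "L2_norm M (\<lambda>x. a * f x - a * f' x) = cmod a * L2_norm M (\<lambda>x. f x - f' x)"
      by (simp add: L2_norm_cmult flip: right_diff_distrib)
    also have "\<dots> < \<epsilon>"
      using f'(2) False by (simp add: field_simps)
    finally show ?thesis
      by (intro bexI[OF _ lin_span_cmult[OF f'(1), of a]])
  qed
  then show ?thesis
    using L2_cmult[OF fL] by (simp add: closed_span_def)
qed

lemma closed_span_sum:
  assumes B: "B \<subseteq> L2 M" and "\<And>i. i \<in> I \<Longrightarrow> f i \<in> closed_span M B"
  shows "(\<lambda>x. \<Sum>i\<in>I. f i x) \<in> closed_span M B"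
  using assms(2)
  by (induction I rule: infinite_finite_induct) (auto intro: closed_span_zero closed_span_add[OF B])

lemma closed_span_closed:
  assumes B: "B \<subseteq> L2 M" and f: "f \<in> L2 M"
    and approx: "\<And>\<epsilon>. \<epsilon> > 0 \<Longrightarrow> \<exists>g\<in>closed_span M B. L2_norm M (\<lambda>x. f x - g x) < \<epsilon>"
  shows "f \<in> closed_span M B"
proof -
  have "\<exists>h\<in>lin_span B. L2_norm M (\<lambda>x. f x - h x) < \<epsilon>" if \<epsilon>: "\<epsilon> > 0" for \<epsilon>
  proof -
    obtain g where g: "g \<in> closed_span M B" "L2_norm M (\<lambda>x. f x - g x) < \<epsilon> / 2"
      using approx[of "\<epsilon> / 2"] \<epsilon> by auto
    obtain h where h: "h \<in> lin_span B" "L2_norm M (\<lambda>x. g x - h x) < \<epsilon> / 2"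
      using closed_span_D[OF g(1), of "\<epsilon> / 2"] \<epsilon> by auto
    have gL: "g \<in> L2 M"
      using g closed_span_L2 by blast
    have "L2_norm M (\<lambda>x. (f x - g x) + (g x - h x)) \<le> L2_norm M (\<lambda>x. f x - g x) + L2_norm M (\<lambda>x. g x - h x)"
      by (intro L2_norm_triangle L2_diff f gL lin_span_L2[OF B] h)
    then show ?thesis
      using g h by (intro bexI[of _ h]) auto
  qed
  then show ?thesis
    using f by (simp add: closed_span_def)
qed

text \<open>A linear combination of limits is again a limit, and so is a limit of limits. Inclusions
  between closed spans thereby reduce to placing the generators.\<close>

lemma closed_span_least:
  assumes B: "B \<subseteq> L2 M" and D: "D \<subseteq> closed_span M B"
  shows "closed_span M D \<subseteq> closed_span M B"
proof
  fix f assume f: "f \<in> closed_span M D"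
  have "lin_span D \<subseteq> closed_span M B"
  proof
    fix g assume "g \<in> lin_span D"
    then obtain F a where g: "g = (\<lambda>x. \<Sum>b\<in>F. a b * b x)" "finite F" "F \<subseteq> D"
      unfolding lin_span_def by blast
    show "g \<in> closed_span M B"
      unfolding g(1) using g(3) D by (intro closed_span_sum[OF B] closed_span_cmult) auto
  qed
  show "f \<in> closed_span M B"
  proof (rule closed_span_closed[OF B])
    show "f \<in> L2 M"
      using f closed_span_L2 by (rule subsetD[rotated])
    show "\<exists>g\<in>closed_span M B. L2_norm M (\<lambda>x. f x - g x) < \<epsilon>" if \<epsilon>: "\<epsilon> > 0" for \<epsilon>
    proof -
      obtain g where "g \<in> lin_span D" "L2_norm M (\<lambda>x. f x - g x) < \<epsilon>"
        using closed_span_D[OF f \<epsilon>] .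
      with \<open>lin_span D \<subseteq> closed_span M B\<close> show ?thesis
        by (intro bexI[of _ g]) auto
    qed
  qed
qed

lemma closed_span_idem:
  assumes "B \<subseteq> L2 M"
  shows "closed_span M (closed_span M B) = closed_span M B"
proof
  show "closed_span M (closed_span M B) \<subseteq> closed_span M B"
    by (rule closed_span_least[OF assms subset_refl])
  show "closed_span M B \<subseteq> closed_span M (closed_span M B)"
    by (rule subsetI) (rule closed_span_base[OF closed_span_L2])
qed

section \<open>Orthogonality and approximation in closed spans\<close>

lemma L2_inner_sum_left:
  assumes "\<And>i. i \<in> I \<Longrightarrow> f i \<in> L2 M" "g \<in> L2 M"
  shows "L2_inner M (\<lambda>x. \<Sum>i\<in>I. a i * f i x) g = (\<Sum>i\<in>I. a i * L2_inner M (f i) g)"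
proof -
  have "L2_inner M (\<lambda>x. \<Sum>i\<in>I. a i * f i x) g = (\<integral>x. (\<Sum>i\<in>I. a i * (f i x * cnj (g x))) \<partial>M)"
    by (simp add: L2_inner_def sum_distrib_right mult.assoc)
  also have "\<dots> = (\<Sum>i\<in>I. a i * L2_inner M (f i) g)"
    unfolding L2_inner_def
    by (subst Bochner_Integration.integral_sum)
      (auto intro!: L2_integrable_mult assms)
  finally show ?thesis .
qed

lemma L2_inner_sum_right:
  assumes "\<And>i. i \<in> I \<Longrightarrow> f i \<in> L2 M" "g \<in> L2 M"
  shows "L2_inner M g (\<lambda>x. \<Sum>i\<in>I. a i * f i x) = (\<Sum>i\<in>I. cnj (a i) * L2_inner M g (f i))"
  by (subst L2_inner_cnj, subst L2_inner_sum_left[OF assms]) (simp_all add: L2_inner_cnj[of M g])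

text \<open>If h is a combination of elements of B close to f, the inner products of f and of f - h
  with g agree, and Cauchy-Schwarz makes the latter small.\<close>

lemma closed_span_orthogonal:
  assumes B: "B \<subseteq> L2 M" and g: "g \<in> L2 M" and orth: "\<And>b. b \<in> B \<Longrightarrow> L2_inner M b g = 0"
    and f: "f \<in> closed_span M B"
  shows "L2_inner M f g = 0"
proof (rule ccontr)
  assume ne: "L2_inner M f g \<noteq> 0"
  have fL: "f \<in> L2 M"
    using f closed_span_L2 by blast
  \<comment> \<open>The summand 1 keeps the denominator positive when g has norm zero, and it makes
    the final comparison strict.\<close>
  define \<epsilon> where "\<epsilon> = cmod (L2_inner M f g) / (L2_norm M g + 1)"
  have N: "0 \<le> L2_norm M g"
    by (rule L2_norm_nonneg)
  then have "\<epsilon> > 0"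
    using ne by (simp add: \<epsilon>_def)
  then obtain h where h: "h \<in> lin_span B" "L2_norm M (\<lambda>x. f x - h x) < \<epsilon>"
    using closed_span_D[OF f] by blast
  have hL: "h \<in> L2 M"
    by (rule lin_span_L2[OF B h(1)])
  obtain F a where F: "h = (\<lambda>x. \<Sum>b\<in>F. a b * b x)" "F \<subseteq> B"
    using h(1) unfolding lin_span_def by blast
  have "L2_inner M h g = (\<Sum>b\<in>F. a b * L2_inner M b g)"
    unfolding F(1) using F(2) B by (intro L2_inner_sum_left g) auto
  also have "\<dots> = 0"
    using F(2) orth by (intro sum.neutral) auto
  finally have "L2_inner M h g = 0" .
  moreover have "L2_inner M (\<lambda>x. f x - h x) g = L2_inner M f g - L2_inner M h g"
    unfolding L2_inner_def left_diff_distrib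
    by (intro Bochner_Integration.integral_diff L2_integrable_mult fL hL g)
  ultimately have "cmod (L2_inner M f g) \<le> L2_norm M (\<lambda>x. f x - h x) * L2_norm M g"
    using L2_Cauchy_Schwarz[OF L2_diff[OF fL hL] g] by simp
  also have "\<dots> \<le> \<epsilon> * L2_norm M g"
    using h(2) N by (intro mult_right_mono) auto
  also have "\<dots> < \<epsilon> * (L2_norm M g + 1)"
    using \<open>\<epsilon> > 0\<close> by simp
  also have "\<dots> = cmod (L2_inner M f g)"
    using N by (simp add: \<epsilon>_def)
  finally show False by simp
qed

text \<open>Orthogonality is extended to one closed span at a time; conjugate symmetry brings the
  second argument into first position.\<close>

lemma closed_spans_orthogonal:
  assumes B: "B \<subseteq> L2 M" and D: "D \<subseteq> L2 M"
    and orth: "\<And>b d. b \<in> B \<Longrightarrow> d \<in> D \<Longrightarrow> L2_inner M b d = 0"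
    and f: "f \<in> closed_span M B" and g: "g \<in> closed_span M D"
  shows "L2_inner M f g = 0"
proof (rule closed_span_orthogonal[OF B _ _ f])
  show gL: "g \<in> L2 M"
    using g closed_span_L2 by blast
  fix b assume b: "b \<in> B"
  have "L2_inner M g b = 0"
    using b B orth by (intro closed_span_orthogonal[OF D _ _ g]) (auto simp: L2_inner_cnj[of M _ b])
  then show "L2_inner M b g = 0"
    by (subst L2_inner_cnj) simp
qed

text \<open>Dominated convergence for |f - s i|^2 turns pointwise convergence into convergence in
  norm. The bound w is left general because it is used with the constant 1 for disjoint unions and
  with a multiple of |f| for simple functions.\<close>

lemma closed_span_bounded_limit:
  assumes M: "finite_measure M" and B: "B \<subseteq> L2 M"
    and s: "\<And>i. s i \<in> closed_span M B" and f: "f \<in> L2 M"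
    and lim: "\<And>x. x \<in> space M \<Longrightarrow> (\<lambda>i. s i x) \<longlonglongrightarrow> f x"
    and w: "integrable M (\<lambda>x. (w x)\<^sup>2)" "\<And>i x. x \<in> space M \<Longrightarrow> cmod (f x - s i x) \<le> w x"
  shows "f \<in> closed_span M B"
proof (rule closed_span_closed[OF B f])
  fix \<epsilon> :: real assume \<epsilon>: "\<epsilon> > 0"
  have [measurable]: "f \<in> borel_measurable M" "\<And>i. s i \<in> borel_measurable M"
    using f s closed_span_L2 L2_meas by blast+
  have "(\<lambda>i. \<integral>x. (cmod (f x - s i x))\<^sup>2 \<partial>M) \<longlonglongrightarrow> (\<integral>x. 0 \<partial>M)"
  proof (rule integral_dominated_convergence[OF _ _ w(1)])
    show "AE x in M. (\<lambda>i. (cmod (f x - s i x))\<^sup>2) \<longlonglongrightarrow> 0"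
    proof (rule AE_I2)
      fix x assume "x \<in> space M"
      then have "(\<lambda>i. (cmod (f x - s i x))\<^sup>2) \<longlonglongrightarrow> (cmod (f x - f x))\<^sup>2"
        by (intro tendsto_power tendsto_norm tendsto_diff tendsto_const lim)
      then show "(\<lambda>i. (cmod (f x - s i x))\<^sup>2) \<longlonglongrightarrow> 0"
        by simp
    qed
    show "AE x in M. norm ((cmod (f x - s i x))\<^sup>2) \<le> (w x)\<^sup>2" for i
      using w(2) by (intro AE_I2) (auto intro!: power_mono)
  qed measurable
  then have "(\<lambda>i. L2_norm M (\<lambda>x. f x - s i x)) \<longlonglongrightarrow> 0"
    unfolding L2_norm_def using tendsto_real_sqrt[of _ 0] by simp
  then have "\<forall>\<^sub>F i in sequentially. L2_norm M (\<lambda>x. f x - s i x) < \<epsilon>"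
    using \<epsilon> by (simp add: order_tendsto_iff)
  then obtain i where "L2_norm M (\<lambda>x. f x - s i x) < \<epsilon>"
    by (auto simp: eventually_sequentially)
  then show "\<exists>g\<in>closed_span M B. L2_norm M (\<lambda>x. f x - g x) < \<epsilon>"
    using s by blast
qed

text \<open>The measurable sets whose indicators are \<open>L\<^sup>2\<close> limits form a Dynkin system.\<close>

lemma L2_eq_closed_span_indicators:
  fixes M :: "'x measure"
  assumes M: "finite_measure M"
    and G: "Int_stable G" "G \<subseteq> Pow (space M)" "sets M = sigma_sets (space M) G"
    and B: "B \<subseteq> L2 M"
    and ind: "\<And>A. A \<in> G \<Longrightarrow> (indicator A :: 'x \<Rightarrow> complex) \<in> closed_span M B"
    and top: "(indicator (space M) :: 'x \<Rightarrow> complex) \<in> closed_span M B"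
  shows "L2 M = closed_span M B"
proof -
  interpret finite_measure M by (rule M)
  have sets: "(indicator A :: 'x \<Rightarrow> complex) \<in> closed_span M B" if "A \<in> sets M" for A
  proof -
    from that have "A \<in> sigma_sets (space M) G"
      using G(3) by simp
    with G(1,2) show ?thesis
    proof (induction rule: sigma_sets_induct_disjoint)
      case (basic A)
      then show ?case by (rule ind)
    next
      case empty
      then show ?case by (simp add: indicator_def closed_span_zero)
    next
      case (compl A)
      have "A \<subseteq> space M"
        using compl(1) G(2) sigma_sets_into_sp by blast
      then have "(\<lambda>x. indicator (space M) x + (- 1) * indicator A x) = (indicator (space M - A) :: 'x \<Rightarrow> complex)"
        by (auto simp: indicator_def fun_eq_iff)
      then show ?case
        using closed_span_add[OF B top closed_span_cmult[OF compl(2), of "- 1"]] by simp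
    next
      case (union A)
      have Am: "A i \<in> sets M" for i
        using union(2) G(3) by auto
      have "(\<lambda>x. \<Sum>i<n. indicator (A i) x) = (indicator (\<Union>i<n. A i) :: 'x \<Rightarrow> complex)" for n
        using union(1)
        by (intro ext indicator_UN_disjoint[symmetric])
          (auto simp: disjoint_family_on_def)
      then have n: "(indicator (\<Union>i<n. A i) :: 'x \<Rightarrow> complex) \<in> closed_span M B" for n
        using closed_span_sum[OF B, of "{..<n}" "\<lambda>i. indicator (A i)"] union(3) by simp
      show ?case
      proof (rule closed_span_bounded_limit[OF M B n])
        show "(indicator (\<Union>i. A i) :: 'x \<Rightarrow> complex) \<in> L2 M"
          using Am by (intro L2_bounded[OF M, where B = 1]) (auto simp: indicator_def)
        show "(\<lambda>n. indicator (\<Union>i<n. A i) x :: complex) \<longlonglongrightarrow> indicator (\<Union>i. A i) x" for x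
          by (rule LIMSEQ_indicator_UN)
        show "integrable M (\<lambda>x. (1::real)\<^sup>2)"
          by simp
        show "cmod (indicator (\<Union>i. A i) x - indicator (\<Union>i<n. A i) x) \<le> 1" for n x
          by (auto simp: indicator_def)
      qed
    qed
  qed
  show ?thesis
  proof
    show "L2 M \<subseteq> closed_span M B"
    proof
      fix f assume f: "f \<in> L2 M"
      obtain F where F: "\<And>i. simple_function M (F i)" "\<And>x. x \<in> space M \<Longrightarrow> (\<lambda>i. F i x) \<longlonglongrightarrow> f x"
        "\<And>i x. x \<in> space M \<Longrightarrow> dist (F i x) 0 \<le> 2 * dist (f x) 0"
        using borel_measurable_implies_sequence_metric[OF L2_meas[OF f], of 0] by blast
      \<comment> \<open>Off \<open>space M\<close> the values of \<open>F i\<close> are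
        unconstrained, so the finite sum of indicators represents \<open>F i\<close> only on
        \<open>space M\<close>; hence the detour through equality almost everywhere.\<close>
      have simple: "F i \<in> closed_span M B" for i
      proof (rule closed_span_cong_AE[OF B])
        show "(\<lambda>x. \<Sum>y\<in>F i ` space M. y * indicator (F i -` {y} \<inter> space M) x) \<in> closed_span M B"
          using F(1) by (intro closed_span_sum[OF B] closed_span_cmult sets) (auto simp: simple_function_def)
        show "AE x in M. (\<Sum>y\<in>F i ` space M. y * indicator (F i -` {y} \<inter> space M) x) = F i x"
        proof (rule AE_I2)
          fix x assume x: "x \<in> space M"
          have "(\<Sum>y\<in>F i ` space M. y * indicator (F i -` {y} \<inter> space M) x) = (\<Sum>y\<in>F i ` space M. if y = F i x then y else 0)"
            using x by (intro sum.cong) (auto simp: indicator_def)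
          also have "\<dots> = F i x"
            using F(1) x by (subst sum.delta) (auto simp: simple_function_def)
          finally show "(\<Sum>y\<in>F i ` space M. y * indicator (F i -` {y} \<inter> space M) x) = F i x" .
        qed
      qed (use F(1) borel_measurable_simple_function in auto)
      show "f \<in> closed_span M B"
      proof (rule closed_span_bounded_limit[OF M B simple f F(2)])
        \<comment> \<open>The approximants satisfy |F i| \<le> 2|f|, hence |f - F i| \<le>
          3|f|.\<close>
        show "integrable M (\<lambda>x. (3 * cmod (f x))\<^sup>2)"
          using L2_norm_integrable[OF f] by (simp add: power_mult_distrib)
        show "cmod (f x - F i x) \<le> 3 * cmod (f x)" if "x \<in> space M" for i x
          using F(3)[OF that, of i] norm_triangle_ineq4[of "f x" "F i x"] by simp
      qed
    qed
  qed (rule closed_span_L2)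
qed

section \<open>Factorization and infinite paths\<close>

lemma vec_nat_le_add: "(p :: nat ^ 'k::finite) \<le> p + q"
  by (simp add: less_eq_vec_def)

lemma vec_nat_zero_le: "(0 :: nat ^ 'k::finite) \<le> p"
  by (simp add: less_eq_vec_def)

lemma vec_nat_le_diff: "(p :: nat ^ 'k::finite) \<le> q \<Longrightarrow> p + (q - p) = q"
  by (simp add: less_eq_vec_def vec_eq_iff)

lemma vec_nat_add_diff: "(p :: nat ^ 'k::finite) + q - p = q"
  by (simp add: vec_eq_iff)

lemma vec_nat_diff_add_cancel: "(n + p) - (m + p) = n - (m :: nat ^ 'k::finite)"
  by (simp add: vec_eq_iff)

lemma vec_nat_diff_zero: "p - 0 = (p :: nat ^ 'k::finite)"
  by (simp add: vec_eq_iff)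

lemma diag_zero: "diag 0 = 0"
  by (simp add: diag_def vec_eq_iff)

lemma diag_add: "diag (m + n) = diag m + diag n"
  by (simp add: diag_def vec_eq_iff)

lemma diag_mono: "m \<le> n \<Longrightarrow> (diag m :: nat ^ 'k::finite) \<le> diag n"
  by (simp add: diag_def less_eq_vec_def)

lemma le_diag_ex: "\<exists>n. (p :: nat ^ 'k::finite) \<le> diag n"
proof
  show "p \<le> diag (Max (range (\<lambda>i. p $ i)))"
    by (simp add: diag_def less_eq_vec_def)
qed

lemma mor_Omega: "(p, q) \<in> mor Omega \<longleftrightarrow> p \<le> q"
  by (simp add: Omega_def)

context k_graph
begin

section \<open>Composition and unique factorization\<close>

lemma vertexD:
  assumes "v \<in> vertices \<Lambda>"
  shows "v \<in> mor \<Lambda>" "rng \<Lambda> v = v" "src \<Lambda> v = v"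
  using assms by (auto simp: vertices_def)

text \<open>Equal degrees of the left factors force equal degrees of the right ones by cancellation
  in the monoid of degrees, so the factorization property applies. With equal left factors the
  second conclusion is left cancellation.\<close>

lemma factorization_unique:
  assumes "\<mu> \<in> mor \<Lambda>" "\<nu> \<in> mor \<Lambda>" "src \<Lambda> \<mu> = rng \<Lambda> \<nu>"
    and "\<mu>' \<in> mor \<Lambda>" "\<nu>' \<in> mor \<Lambda>" "src \<Lambda> \<mu>' = rng \<Lambda> \<nu>'"
    and eq: "cmp \<Lambda> \<mu> \<nu> = cmp \<Lambda> \<mu>' \<nu>'" and deg: "deg \<Lambda> \<mu> = deg \<Lambda> \<mu>'"
  shows "\<mu> = \<mu>'" "\<nu> = \<nu>'"
proof -
  have d: "deg \<Lambda> (cmp \<Lambda> \<mu> \<nu>) = deg \<Lambda> \<mu> + deg \<Lambda> \<nu>"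
    using assms(1-3) by (rule deg_cmp)
  have "deg \<Lambda> (cmp \<Lambda> \<mu>' \<nu>') = deg \<Lambda> \<mu>' + deg \<Lambda> \<nu>'"
    using assms(4-6) by (rule deg_cmp)
  then have "deg \<Lambda> \<nu> = deg \<Lambda> \<nu>'"
    using d eq deg by simp
  moreover have "\<exists>!(\<alpha>, \<beta>). \<alpha> \<in> mor \<Lambda> \<and> \<beta> \<in> mor \<Lambda> \<and> src \<Lambda> \<alpha> = rng \<Lambda> \<beta> \<and>
      cmp \<Lambda> \<mu> \<nu> = cmp \<Lambda> \<alpha> \<beta> \<and> deg \<Lambda> \<alpha> = deg \<Lambda> \<mu> \<and> deg \<Lambda> \<beta> = deg \<Lambda> \<nu>"
    using assms(1-3) d by (intro factorization cmp_closed)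
  ultimately have "(\<mu>, \<nu>) = (\<mu>', \<nu>')"
    using assms by (elim ex1E) (metis (mono_tags, lifting) case_prod_conv)
  then show "\<mu> = \<mu>'" "\<nu> = \<nu>'"
    by auto
qed

lemma factorization_obtain:
  assumes "\<eta> \<in> mor \<Lambda>" "deg \<Lambda> \<eta> = m + n"
  obtains \<mu> \<nu> where "\<mu> \<in> mor \<Lambda>" "\<nu> \<in> mor \<Lambda>" "src \<Lambda> \<mu> = rng \<Lambda> \<nu>" "\<eta> = cmp \<Lambda> \<mu> \<nu>"
    "deg \<Lambda> \<mu> = m" "deg \<Lambda> \<nu> = n"
  using ex1_implies_ex[OF factorization[OF assms]] by auto

text \<open>Both r(\<eta>)\<eta> and \<eta>s(\<eta>) are factorizations of \<eta> into factors of
  degree 0, so their left factors coincide.\<close>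

lemma deg_zero_vertex:
  assumes "\<eta> \<in> mor \<Lambda>" "deg \<Lambda> \<eta> = 0"
  shows "\<eta> \<in> vertices \<Lambda>"
proof -
  have r: "rng \<Lambda> \<eta> \<in> vertices \<Lambda>" and s: "src \<Lambda> \<eta> \<in> vertices \<Lambda>"
    using assms rng_vertex src_vertex by auto
  have "rng \<Lambda> \<eta> = \<eta>"
    by (rule factorization_unique(1)[of _ \<eta> \<eta> "src \<Lambda> \<eta>"])
      (use assms r s vertexD deg_vertex cmp_rng cmp_src in auto)
  then show ?thesis
    using r by simp
qed

section \<open>Infinite paths and their initial segments\<close>

lemma infinite_pathD:
  assumes "x \<in> infinite_paths \<Lambda>"
  shows "p \<le> q \<Longrightarrow> x (p, q) \<in> mor \<Lambda>"
    and "p \<le> q \<Longrightarrow> rng \<Lambda> (x (p, q)) = x (p, p)"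
    and "p \<le> q \<Longrightarrow> src \<Lambda> (x (p, q)) = x (q, q)"
    and "p \<le> q \<Longrightarrow> deg \<Lambda> (x (p, q)) = q - p"
    and "p \<le> q \<Longrightarrow> q \<le> r \<Longrightarrow> cmp \<Lambda> (x (p, q)) (x (q, r)) = x (p, r)"
proof -
  have "kgraph_morphism Omega \<Lambda> x"
    using assms by (simp add: infinite_paths_def)
  then have 1: "\<forall>a \<in> mor Omega. x a \<in> mor \<Lambda> \<and> x (rng Omega a) = rng \<Lambda> (x a) \<and>
      x (src Omega a) = src \<Lambda> (x a) \<and> deg \<Lambda> (x a) = deg Omega a"
    and 2: "\<forall>a \<in> mor Omega. \<forall>b \<in> mor Omega. src Omega a = rng Omega b \<longrightarrow>
      x (cmp Omega a b) = cmp \<Lambda> (x a) (x b)"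
    by (auto simp: kgraph_morphism_def)
  {
    assume "p \<le> q"
    with 1 have "x (p, q) \<in> mor \<Lambda> \<and> x (rng Omega (p, q)) = rng \<Lambda> (x (p, q)) \<and>
      x (src Omega (p, q)) = src \<Lambda> (x (p, q)) \<and> deg \<Lambda> (x (p, q)) = deg Omega (p, q)"
      by (simp add: mor_Omega)
    then show "x (p, q) \<in> mor \<Lambda>" "rng \<Lambda> (x (p, q)) = x (p, p)"
      "src \<Lambda> (x (p, q)) = x (q, q)" "deg \<Lambda> (x (p, q)) = q - p"
      by (auto simp: Omega_def)
  }
  assume "p \<le> q" "q \<le> r"
  then have "src Omega (p, q) = rng Omega (q, r) \<longrightarrow>
      x (cmp Omega (p, q) (q, r)) = cmp \<Lambda> (x (p, q)) (x (q, r))"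
    using 2 by (simp add: mor_Omega)
  then show "cmp \<Lambda> (x (p, q)) (x (q, r)) = x (p, r)"
    by (simp add: Omega_def)
qed

lemma infinite_pathsI:
  assumes "\<And>p q. p \<le> q \<Longrightarrow> y p q \<in> mor \<Lambda>"
    and "\<And>p q. p \<le> q \<Longrightarrow> rng \<Lambda> (y p q) = y p p"
    and "\<And>p q. p \<le> q \<Longrightarrow> src \<Lambda> (y p q) = y q q"
    and "\<And>p q. p \<le> q \<Longrightarrow> deg \<Lambda> (y p q) = q - p"
    and "\<And>p q r. p \<le> q \<Longrightarrow> q \<le> r \<Longrightarrow> y p r = cmp \<Lambda> (y p q) (y q r)"
  shows "(\<lambda>(p, q)\<in>mor Omega. y p q) \<in> infinite_paths \<Lambda>"
proof -
  let ?x = "\<lambda>(p, q)\<in>mor Omega. y p q"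
  have x: "?x (p, q) = y p q" if "p \<le> q" for p q
    using that by (simp add: mor_Omega)
  have "kgraph_morphism Omega \<Lambda> ?x"
    unfolding kgraph_morphism_def
  proof (intro conjI ballI impI)
    fix a :: "(nat ^ 'k) \<times> (nat ^ 'k)" assume "a \<in> mor Omega"
    then obtain p q where a: "a = (p, q)" "p \<le> q"
      by (cases a) (auto simp: mor_Omega)
    show "?x a \<in> mor \<Lambda>" "?x (rng Omega a) = rng \<Lambda> (?x a)" "?x (src Omega a) = src \<Lambda> (?x a)"
      "deg \<Lambda> (?x a) = deg Omega a"
      using a(2) assms(1-4)[OF a(2)] by (auto simp: a(1) Omega_def)
  next
    fix a b :: "(nat ^ 'k) \<times> (nat ^ 'k)"
    assume "a \<in> mor Omega" "b \<in> mor Omega" "src Omega a = rng Omega b"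
    then obtain p q r where ab: "a = (p, q)" "b = (q, r)" "p \<le> q" "q \<le> r"
      by (cases a; cases b) (auto simp: Omega_def)
    then have "p \<le> r"
      by (blast intro: order_trans)
    have "cmp Omega a b = (p, r)"
      by (simp add: ab(1,2) Omega_def)
    then show "?x (cmp Omega a b) = cmp \<Lambda> (?x a) (?x b)"
      using x[OF ab(3)] x[OF ab(4)] x[OF \<open>p \<le> r\<close>] assms(5)[OF ab(3,4)] ab(1,2) by metis
  qed
  then show ?thesis
    unfolding infinite_paths_def by simp
qed

text \<open>The segment from p to q is what remains of the initial segment of degree q after
  removing that of degree p; left cancellation recovers it. Outside \<open>mor Omega\<close>
  extensionality takes over.\<close>

lemma infinite_path_eqI:
  assumes x: "x \<in> infinite_paths \<Lambda>" and y: "y \<in> infinite_paths \<Lambda>"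
    and eq: "\<And>q. x (0, q) = y (0, q)"
  shows "x = y"
proof (rule extensionalityI[of _ "mor Omega"])
  show "x \<in> extensional (mor Omega)" "y \<in> extensional (mor Omega)"
    using x y by (auto simp: infinite_paths_def)
  fix a :: "(nat ^ 'k) \<times> (nat ^ 'k)" assume "a \<in> mor Omega"
  then obtain p q where a: "a = (p, q)" and pq: "p \<le> q"
    by (cases a) (auto simp: mor_Omega)
  note X = infinite_pathD[OF x] and Y = infinite_pathD[OF y]
  have p0: "0 \<le> p"
    by (rule vec_nat_zero_le)
  have "x (p, q) = y (p, q)"
  proof (rule factorization_unique(2))
    show "cmp \<Lambda> (x (0, p)) (x (p, q)) = cmp \<Lambda> (y (0, p)) (y (p, q))"
      using X(5)[OF p0 pq] Y(5)[OF p0 pq] eq by simp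
  qed (use X(1-4)[OF p0] X(1-4)[OF pq] Y(1-4)[OF p0] Y(1-4)[OF pq] in auto)
  then show "x a = y a"
    by (simp add: a)
qed

text \<open>In a coherent system of initial segments the segment from p to q is the \<nu> with w p
  \<nu> = w q, unique by cancellation. Its identity and composition laws are checked after composing
  with \<open>w p\<close> on the left. A path can thus be built by prescribing one segment per
  degree.\<close>

lemma infinite_path_of_prefixes:
  assumes w: "\<And>q. w q \<in> mor \<Lambda>" "\<And>q. deg \<Lambda> (w q) = q"
    and ext: "\<And>p q. p \<le> q \<Longrightarrow> \<exists>\<nu>\<in>mor \<Lambda>. src \<Lambda> (w p) = rng \<Lambda> \<nu> \<and> cmp \<Lambda> (w p) \<nu> = w q"
  obtains x where "x \<in> infinite_paths \<Lambda>" "\<And>q. x (0, q) = w q"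
proof -
  obtain y where y: "\<And>p q. p \<le> q \<Longrightarrow> y p q \<in> mor \<Lambda>"
    "\<And>p q. p \<le> q \<Longrightarrow> src \<Lambda> (w p) = rng \<Lambda> (y p q)"
    "\<And>p q. p \<le> q \<Longrightarrow> cmp \<Lambda> (w p) (y p q) = w q"
    using ext by metis
  have deg: "deg \<Lambda> (y p q) = q - p" if "p \<le> q" for p q
  proof -
    have "q = p + deg \<Lambda> (y p q)"
      using deg_cmp[OF w(1) y(1,2)[OF that]] y(3)[OF that] w(2) by simp
    then show ?thesis
      by (metis vec_nat_add_diff)
  qed
  have pp: "y p p = src \<Lambda> (w p)" for p
  proof (rule factorization_unique(2)[of "w p" _ "w p"])
    show "cmp \<Lambda> (w p) (y p p) = cmp \<Lambda> (w p) (src \<Lambda> (w p))"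
      using y(3)[of p p] cmp_src[OF w(1)] by simp
  qed (use y(1)[of p p] y(2)[of p p, symmetric] w vertexD[OF src_vertex[OF w(1)]] in auto)
  have sq: "src \<Lambda> (y p q) = src \<Lambda> (w q)" if "p \<le> q" for p q
    using src_cmp[OF w(1) y(1,2)[OF that]] y(3)[OF that] by simp
  have "(\<lambda>(p, q)\<in>mor Omega. y p q) \<in> infinite_paths \<Lambda>"
  proof (rule infinite_pathsI)
    fix p q r :: "nat ^ 'k" assume pq: "p \<le> q" and qr: "q \<le> r"
    then have pr: "p \<le> r" by (rule order_trans)
    have c: "src \<Lambda> (y p q) = rng \<Lambda> (y q r)"
      using sq[OF pq] y(2)[OF qr] by simp
    show "y p r = cmp \<Lambda> (y p q) (y q r)"
    proof (rule factorization_unique(2)[of "w p" _ "w p"])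
      have "cmp \<Lambda> (w p) (cmp \<Lambda> (y p q) (y q r)) = cmp \<Lambda> (cmp \<Lambda> (w p) (y p q)) (y q r)"
        using cmp_assoc[OF w(1) y(1)[OF pq] y(1)[OF qr] y(2)[OF pq] c] by simp
      then show "cmp \<Lambda> (w p) (y p r) = cmp \<Lambda> (w p) (cmp \<Lambda> (y p q) (y q r))"
        using y(3) pq qr pr by simp
    qed (use y(1)[OF pr] y(2)[OF pr, symmetric] y(2)[OF pq, symmetric] w
        cmp_closed[OF y(1)[OF pq] y(1)[OF qr] c] rng_cmp[OF y(1)[OF pq] y(1)[OF qr] c] in auto)
  qed (use y deg pp sq in auto)
  moreover have "y 0 q = w q" for q
  proof -
    have 0: "(0 :: nat ^ 'k) \<le> q"
      by (rule vec_nat_zero_le)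
    have "w 0 \<in> vertices \<Lambda>"
      using w by (intro deg_zero_vertex) auto
    then have "w 0 = rng \<Lambda> (y 0 q)"
      using y(2)[OF 0] vertexD by simp
    then show ?thesis
      using cmp_rng[OF y(1)[OF 0]] y(3)[OF 0] by simp
  qed
  ultimately show thesis
    by (intro that) (auto simp: mor_Omega vec_nat_zero_le)
qed

section \<open>Shifting, prefixing and cylinder sets\<close>

lemma shift_apply: "m \<le> n \<Longrightarrow> shift p x (m, n) = x (m + p, n + p)"
  by (simp add: shift_def mor_Omega)

lemma shift_infinite_path:
  assumes "x \<in> infinite_paths \<Lambda>"
  shows "shift p x \<in> infinite_paths \<Lambda>"
  unfolding shift_def
proof (rule infinite_pathsI)
  fix m n r :: "nat ^ 'k" assume mn: "m \<le> n"
  then have mn': "m + p \<le> n + p"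
    by (simp add: less_eq_vec_def)
  note X = infinite_pathD[OF assms mn']
  show "x (m + p, n + p) \<in> mor \<Lambda>" "rng \<Lambda> (x (m + p, n + p)) = x (m + p, m + p)"
    "src \<Lambda> (x (m + p, n + p)) = x (n + p, n + p)" "deg \<Lambda> (x (m + p, n + p)) = n - m"
    using X(1-4) by (simp_all add: vec_nat_diff_add_cancel)
  assume "n \<le> r"
  then have "n + p \<le> r + p"
    by (simp add: less_eq_vec_def)
  then show "x (m + p, r + p) = cmp \<Lambda> (x (m + p, n + p)) (x (n + p, r + p))"
    using X(5) by simp
qed

lemma cylinderD:
  assumes "x \<in> cylinder \<Lambda> \<eta>"
  shows "x \<in> infinite_paths \<Lambda>" "x (0, deg \<Lambda> \<eta>) = \<eta>" "x (0, 0) = rng \<Lambda> \<eta>"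
    "x (deg \<Lambda> \<eta>, deg \<Lambda> \<eta>) = src \<Lambda> \<eta>" "\<eta> \<in> mor \<Lambda>"
proof -
  show x: "x \<in> infinite_paths \<Lambda>" and e: "x (0, deg \<Lambda> \<eta>) = \<eta>"
    using assms by (auto simp: cylinder_def)
  show "x (0, 0) = rng \<Lambda> \<eta>" "x (deg \<Lambda> \<eta>, deg \<Lambda> \<eta>) = src \<Lambda> \<eta>" "\<eta> \<in> mor \<Lambda>"
    using infinite_pathD(1-3)[OF x, of 0 "deg \<Lambda> \<eta>"] e by (auto simp: vec_nat_zero_le)
qed

text \<open>Unique factorization splits the segment of degree d(\<eta>\<mu>) at d(\<eta>). For
  functions this means that on Z(\<eta>) the indicator of Z(\<eta>\<mu>) is the indicator of
  Z(\<mu>) composed with the shift, which is how prefixing acts on wavelets.\<close>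

lemma cylinder_cmp_iff:
  assumes \<eta>: "\<eta> \<in> mor \<Lambda>" and \<mu>: "\<mu> \<in> mor \<Lambda>" and c: "src \<Lambda> \<eta> = rng \<Lambda> \<mu>"
  shows "x \<in> cylinder \<Lambda> (cmp \<Lambda> \<eta> \<mu>) \<longleftrightarrow> x \<in> cylinder \<Lambda> \<eta> \<and> shift (deg \<Lambda> \<eta>) x \<in> cylinder \<Lambda> \<mu>"
proof (cases "x \<in> infinite_paths \<Lambda>")
  case True
  note X = infinite_pathD[OF True]
  let ?d = "deg \<Lambda> \<eta>" and ?e = "deg \<Lambda> \<mu>"
  have 0: "0 \<le> ?d" "?d \<le> ?d + ?e" "0 \<le> ?d + ?e" "0 \<le> ?e"
    by (rule vec_nat_zero_le vec_nat_le_add)+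
  have eq: "x (0, ?d + ?e) = cmp \<Lambda> (x (0, ?d)) (x (?d, ?d + ?e))"
    using X(5)[OF 0(1,2)] by simp
  have "x (0, ?d + ?e) = cmp \<Lambda> \<eta> \<mu> \<longleftrightarrow> x (0, ?d) = \<eta> \<and> x (?d, ?d + ?e) = \<mu>"
  proof
    assume "x (0, ?d + ?e) = cmp \<Lambda> \<eta> \<mu>"
    then show "x (0, ?d) = \<eta> \<and> x (?d, ?d + ?e) = \<mu>"
      using factorization_unique[of "x (0, ?d)" "x (?d, ?d + ?e)" \<eta> \<mu>] X(1-4)[OF 0(1)] X(1-4)[OF 0(2)] eq \<eta> \<mu> c
      by (simp add: vec_nat_diff_zero)
  qed (use eq in auto)
  then show ?thesis
    using True shift_infinite_path[OF True, of ?d] deg_cmp[OF \<eta> \<mu> c]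
    by (simp add: cylinder_def shift_apply[OF 0(4)] add.commute)
qed (auto simp: cylinder_def)

lemma shift_cylinder:
  assumes "x \<in> cylinder \<Lambda> \<eta>"
  shows "shift (deg \<Lambda> \<eta>) x \<in> cylinder \<Lambda> (src \<Lambda> \<eta>)"
proof -
  note D = cylinderD[OF assms]
  have s: "src \<Lambda> \<eta> \<in> vertices \<Lambda>"
    using D(5) by (rule src_vertex)
  have "x \<in> cylinder \<Lambda> (cmp \<Lambda> \<eta> (src \<Lambda> \<eta>))"
    using assms cmp_src[OF D(5)] by simp
  then show ?thesis
    using cylinder_cmp_iff[of \<eta> "src \<Lambda> \<eta>"] D(5) vertexD[OF s] by simp
qed

lemma shift_inj_on: "inj_on (shift (deg \<Lambda> \<eta>)) (cylinder \<Lambda> \<eta>)"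
proof (rule inj_onI)
  fix x y assume xy: "x \<in> cylinder \<Lambda> \<eta>" "y \<in> cylinder \<Lambda> \<eta>"
    and eq: "shift (deg \<Lambda> \<eta>) x = shift (deg \<Lambda> \<eta>) y"
  note x = cylinderD[OF xy(1)] and y = cylinderD[OF xy(2)]
  let ?d = "deg \<Lambda> \<eta>"
  \<comment> \<open>The degrees q and d(\<eta>) need not be comparable, so the two paths are
    compared at degree q + d(\<eta>) and then cut back to q.\<close>
  have "x (0, q) = y (0, q)" for q
  proof -
    have 0: "0 \<le> ?d" "0 \<le> q" "?d \<le> q + ?d" "q \<le> q + ?d"
      using vec_nat_le_add[of ?d q] by (auto intro: vec_nat_zero_le vec_nat_le_add simp: add.commute)
    have "x (0 + ?d, q + ?d) = y (0 + ?d, q + ?d)"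
      using shift_apply[OF 0(2), of ?d x] shift_apply[OF 0(2), of ?d y] eq by simp
    then have "x (0, q + ?d) = y (0, q + ?d)"
      using infinite_pathD(5)[OF x(1) 0(1,3)] infinite_pathD(5)[OF y(1) 0(1,3)] x(2) y(2)
      by simp
    then show ?thesis
      using infinite_pathD(5)[OF x(1) 0(2,4)] infinite_pathD(5)[OF y(1) 0(2,4)]
        infinite_pathD(1-4)[OF x(1) 0(2)] infinite_pathD(1-4)[OF y(1) 0(2)]
        infinite_pathD(1-4)[OF x(1) 0(4)] infinite_pathD(1-4)[OF y(1) 0(4)]
      by (intro factorization_unique(1)[of "x (0, q)" "x (q, q + ?d)" "y (0, q)" "y (q, q + ?d)"]) auto
  qed
  then show "x = y"
    using infinite_path_eqI x(1) y(1) by blast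
qed

text \<open>The preimage is \<eta>x. Its initial segment of degree q is cut out of \<eta> x(0, q),
  whose degree q + d(\<eta>) is at least q for every q; the resulting segments \<open>w q\<close>
  are coherent and assemble into an infinite path.\<close>

lemma shift_surj:
  assumes \<eta>: "\<eta> \<in> mor \<Lambda>" and x: "x \<in> cylinder \<Lambda> (src \<Lambda> \<eta>)"
  shows "\<exists>y\<in>cylinder \<Lambda> \<eta>. shift (deg \<Lambda> \<eta>) y = x"
proof -
  let ?d = "deg \<Lambda> \<eta>"
  let ?e = "\<lambda>q. cmp \<Lambda> \<eta> (x (0, q))"
  have s: "src \<Lambda> \<eta> \<in> vertices \<Lambda>"
    using \<eta> by (rule src_vertex)
  have xi: "x \<in> infinite_paths \<Lambda>" and x0: "x (0, 0) = src \<Lambda> \<eta>"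
    using cylinderD[OF x] vertexD[OF s] by auto
  note X = infinite_pathD[OF xi]
  have Z: "0 \<le> q" for q :: "nat ^ 'k"
    by (rule vec_nat_zero_le)
  have c: "src \<Lambda> \<eta> = rng \<Lambda> (x (0, q))" for q
    using X(2)[OF Z] x0 by simp
  have e: "?e q \<in> mor \<Lambda>" "deg \<Lambda> (?e q) = q + ?d" "src \<Lambda> (?e q) = x (q, q)" for q
    using cmp_closed[OF \<eta> X(1)[OF Z] c] deg_cmp[OF \<eta> X(1)[OF Z] c] src_cmp[OF \<eta> X(1)[OF Z] c]
      X(3,4)[OF Z] by (auto simp: vec_nat_diff_zero add.commute)
  have e_ext: "?e r = cmp \<Lambda> (?e q) (x (q, r))" if "q \<le> r" for q r
    using X(5)[OF Z that] cmp_assoc[OF \<eta> X(1)[OF Z] X(1)[OF that] c] X(3)[OF Z] X(2)[OF that] by simp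
  have "\<exists>\<mu>. \<mu> \<in> mor \<Lambda> \<and> deg \<Lambda> \<mu> = q \<and> (\<exists>\<nu>\<in>mor \<Lambda>. src \<Lambda> \<mu> = rng \<Lambda> \<nu> \<and> ?e q = cmp \<Lambda> \<mu> \<nu>)" for q
    using factorization_obtain[OF e(1,2)[of q]] by metis
  then obtain w where w: "\<And>q. w q \<in> mor \<Lambda>" "\<And>q. deg \<Lambda> (w q) = q"
    and we: "\<And>q. \<exists>\<nu>\<in>mor \<Lambda>. src \<Lambda> (w q) = rng \<Lambda> \<nu> \<and> ?e q = cmp \<Lambda> (w q) \<nu>"
    by metis
  \<comment> \<open>Since \<open>?e r\<close> extends \<open>?e q\<close>, its initial segment of
    degree q is again \<open>w q\<close>; this independence of r is what gives coherence.\<close>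
  have w_eq: "\<alpha> = w q" if \<alpha>: "\<alpha> \<in> mor \<Lambda>" "deg \<Lambda> \<alpha> = q" and
    \<beta>: "\<beta> \<in> mor \<Lambda>" "src \<Lambda> \<alpha> = rng \<Lambda> \<beta>" "cmp \<Lambda> \<alpha> \<beta> = ?e r" and "q \<le> r" for \<alpha> \<beta> q r
  proof -
    obtain \<nu> where \<nu>: "\<nu> \<in> mor \<Lambda>" "src \<Lambda> (w q) = rng \<Lambda> \<nu>" "?e q = cmp \<Lambda> (w q) \<nu>"
      using we by blast
    have sn: "src \<Lambda> \<nu> = rng \<Lambda> (x (q, r))"
      using src_cmp[OF w(1) \<nu>(1,2)] \<nu>(3) e(3)[of q] X(2)[OF \<open>q \<le> r\<close>] by simp
    have "?e r = cmp \<Lambda> (cmp \<Lambda> (w q) \<nu>) (x (q, r))"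
      using e_ext[OF \<open>q \<le> r\<close>] \<nu>(3) by simp
    also have "\<dots> = cmp \<Lambda> (w q) (cmp \<Lambda> \<nu> (x (q, r)))"
      by (rule cmp_assoc[OF w(1) \<nu>(1) X(1)[OF \<open>q \<le> r\<close>] \<nu>(2) sn])
    finally show ?thesis
      using factorization_unique(1)[of \<alpha> \<beta> "w q" "cmp \<Lambda> \<nu> (x (q, r))"] \<alpha> \<beta> w \<nu> sn
        cmp_closed[OF \<nu>(1) X(1)[OF \<open>q \<le> r\<close>] sn] rng_cmp[OF \<nu>(1) X(1)[OF \<open>q \<le> r\<close>] sn]
      by simp
  qed
  obtain y where y: "y \<in> infinite_paths \<Lambda>" "\<And>q. y (0, q) = w q"
  proof (rule infinite_path_of_prefixes[OF w])
    fix p q :: "nat ^ 'k" assume pq: "p \<le> q"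
    obtain \<nu> where \<nu>: "\<nu> \<in> mor \<Lambda>" "src \<Lambda> (w q) = rng \<Lambda> \<nu>" "?e q = cmp \<Lambda> (w q) \<nu>"
      using we by blast
    obtain \<alpha> \<beta> where ab: "\<alpha> \<in> mor \<Lambda>" "\<beta> \<in> mor \<Lambda>" "src \<Lambda> \<alpha> = rng \<Lambda> \<beta>" "w q = cmp \<Lambda> \<alpha> \<beta>" "deg \<Lambda> \<alpha> = p"
      using factorization_obtain[OF w(1)[of q], of p "q - p"] w(2) vec_nat_le_diff[OF pq] by metis
    have bn: "src \<Lambda> \<beta> = rng \<Lambda> \<nu>"
      using src_cmp[OF ab(1-3)] ab(4) \<nu>(2) by simp
    have "cmp \<Lambda> \<alpha> (cmp \<Lambda> \<beta> \<nu>) = ?e q"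
      using cmp_assoc[OF ab(1,2) \<nu>(1) ab(3) bn] ab(4) \<nu>(3) by simp
    then have "\<alpha> = w p"
      using ab \<nu>(1) bn pq cmp_closed rng_cmp by (intro w_eq[of _ p "cmp \<Lambda> \<beta> \<nu>" q]) auto
    then show "\<exists>\<nu>\<in>mor \<Lambda>. src \<Lambda> (w p) = rng \<Lambda> \<nu> \<and> cmp \<Lambda> (w p) \<nu> = w q"
      using ab by auto
  qed blast
  have "\<eta> = w ?d"
    using X(1)[OF Z] c \<eta> by (intro w_eq[of _ _ "x (0, ?d)" ?d]) auto
  then have yc: "y \<in> cylinder \<Lambda> \<eta>"
    using y by (simp add: cylinder_def)
  moreover have "shift ?d y = x"
  proof (rule infinite_path_eqI[OF shift_infinite_path[OF y(1)] xi])
    fix q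
    have "?e q = cmp \<Lambda> (?e q) (x (q, q))"
      by (rule e_ext) simp
    \<comment> \<open>Here \<open>?e q\<close> has degree q + d(\<eta>) and is an initial segment of
      \<open>?e (q + ?d)\<close>, hence the prescribed segment of y of that degree.\<close>
    then have "?e q = w (q + ?d)"
      using e(1,2)[of q] e(3)[of q] e_ext[of q "q + ?d"] X(1,2)[of q "q + ?d"]
      by (intro w_eq[of _ _ "x (q, q + ?d)" "q + ?d"]) (auto simp: vec_nat_le_add)
    then have "y \<in> cylinder \<Lambda> (?e q)"
      using y e(2)[of q] by (simp add: cylinder_def)
    then have "shift ?d y \<in> cylinder \<Lambda> (x (0, q))"
      using cylinder_cmp_iff[OF \<eta> X(1)[OF Z] c] by blast
    then show "shift ?d y (0, q) = x (0, q)"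
      using X(4)[OF Z] by (simp add: cylinder_def vec_nat_diff_zero)
  qed
  ultimately show ?thesis
    by blast
qed

text \<open>As \<open>prefix_map\<close> inverts a bijection between cylinders, its images are
  preimages under the shift. This converts the set function defining
  \<open>pulled_back_measure\<close> into a pushforward.\<close>

lemma prefix_map_image:
  assumes "\<eta> \<in> mor \<Lambda>" "A \<subseteq> cylinder \<Lambda> (src \<Lambda> \<eta>)"
  shows "prefix_map \<Lambda> \<eta> ` A = {x \<in> cylinder \<Lambda> \<eta>. shift (deg \<Lambda> \<eta>) x \<in> A}"
proof -
  have b: "bij_betw (shift (deg \<Lambda> \<eta>)) (cylinder \<Lambda> \<eta>) (cylinder \<Lambda> (src \<Lambda> \<eta>))"
    using shift_inj_on shift_surj[OF assms(1)] shift_cylinder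
    by (auto simp: bij_betw_def)
  have f: "prefix_map \<Lambda> \<eta> a \<in> cylinder \<Lambda> \<eta> \<and> shift (deg \<Lambda> \<eta>) (prefix_map \<Lambda> \<eta> a) = a" if "a \<in> A" for a
    unfolding prefix_map_def
    using b that assms(2) the_inv_into_into[OF shift_inj_on, of a \<eta> "cylinder \<Lambda> \<eta>"]
      f_the_inv_into_f[OF shift_inj_on, of a \<eta>] by (auto simp: bij_betw_def)
  show ?thesis
  proof
    show "prefix_map \<Lambda> \<eta> ` A \<subseteq> {x \<in> cylinder \<Lambda> \<eta>. shift (deg \<Lambda> \<eta>) x \<in> A}"
      using f by auto
    show "{x \<in> cylinder \<Lambda> \<eta>. shift (deg \<Lambda> \<eta>) x \<in> A} \<subseteq> prefix_map \<Lambda> \<eta> ` A"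
    proof clarify
      fix x assume x: "x \<in> cylinder \<Lambda> \<eta>" "shift (deg \<Lambda> \<eta>) x \<in> A"
      have "prefix_map \<Lambda> \<eta> (shift (deg \<Lambda> \<eta>) x) = x"
        unfolding prefix_map_def by (rule the_inv_into_f_f[OF shift_inj_on x(1)])
      with x show "x \<in> prefix_map \<Lambda> \<eta> ` A"
        by (metis imageI)
    qed
  qed
qed

text \<open>Cutting \<eta> at degree d(\<mu>) gives a path \<alpha> with Z(\<eta>) inside
  Z(\<alpha>), and cylinders of equal degree are equal or disjoint. Comparability of the degrees is
  what makes the cut possible.\<close>

lemma cylinder_cases:
  assumes \<eta>: "\<eta> \<in> mor \<Lambda>" and \<mu>: "\<mu> \<in> mor \<Lambda>" and le: "deg \<Lambda> \<mu> \<le> deg \<Lambda> \<eta>"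
  shows "cylinder \<Lambda> \<eta> \<subseteq> cylinder \<Lambda> \<mu> \<or> cylinder \<Lambda> \<eta> \<inter> cylinder \<Lambda> \<mu> = {}"
proof -
  obtain \<alpha> \<beta> where ab: "\<alpha> \<in> mor \<Lambda>" "\<beta> \<in> mor \<Lambda>" "src \<Lambda> \<alpha> = rng \<Lambda> \<beta>" "\<eta> = cmp \<Lambda> \<alpha> \<beta>" "deg \<Lambda> \<alpha> = deg \<Lambda> \<mu>"
    using factorization_obtain[OF \<eta>, of "deg \<Lambda> \<mu>" "deg \<Lambda> \<eta> - deg \<Lambda> \<mu>"] vec_nat_le_diff[OF le] by metis
  have "cylinder \<Lambda> \<eta> \<subseteq> cylinder \<Lambda> \<alpha>"
    using cylinder_cmp_iff[OF ab(1-3)] ab(4) by auto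
  moreover have "\<alpha> = \<mu>" if "x \<in> cylinder \<Lambda> \<alpha>" "x \<in> cylinder \<Lambda> \<mu>" for x
    using that ab(5) by (simp add: cylinder_def)
  ultimately show ?thesis
    by blast
qed

lemma cylinder_disjoint:
  "deg \<Lambda> \<eta> = deg \<Lambda> \<mu> \<Longrightarrow> \<eta> \<noteq> \<mu> \<Longrightarrow> cylinder \<Lambda> \<eta> \<inter> cylinder \<Lambda> \<mu> = {}"
  by (auto simp: cylinder_def)

lemma D_pathsD:
  assumes "l \<in> D_paths \<Lambda> v"
  shows "l \<in> mor \<Lambda>" "deg \<Lambda> l = diag 1" "rng \<Lambda> l = v"
  using assms by (auto simp: D_paths_def)

text \<open>After \<eta> the path x continues with a segment of degree (1, ..., 1), which serves as
  l. Since the cylinders of these extensions are pairwise disjoint, they partition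
  Z(\<eta>).\<close>

lemma cylinder_split:
  assumes x: "x \<in> cylinder \<Lambda> \<eta>"
  shows "\<exists>l\<in>D_paths \<Lambda> (src \<Lambda> \<eta>). x \<in> cylinder \<Lambda> (cmp \<Lambda> \<eta> l)"
proof -
  note D = cylinderD[OF x]
  let ?y = "shift (deg \<Lambda> \<eta>) x"
  have y: "?y \<in> infinite_paths \<Lambda>" "?y (0, 0) = src \<Lambda> \<eta>"
    using shift_infinite_path[OF D(1)] D(4) by (auto simp: shift_apply)
  note Y = infinite_pathD[OF y(1) vec_nat_zero_le, of "diag 1"]
  let ?l = "?y (0, diag 1)"
  have l: "?l \<in> D_paths \<Lambda> (src \<Lambda> \<eta>)"
    using Y(1-4) y(2) by (simp add: D_paths_def vec_nat_diff_zero)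
  moreover have "?y \<in> cylinder \<Lambda> ?l"
    using y(1) Y(4) by (simp add: cylinder_def vec_nat_diff_zero)
  ultimately show ?thesis
    using x D(5) cylinder_cmp_iff[of \<eta> ?l x] D_pathsD[OF l] by auto
qed

end

section \<open>The Perron-Frobenius measure\<close>

locale pf_kgraph = k_graph \<Lambda> for \<Lambda> :: "('a, 'k::finite) kgraph" +
  fixes xL :: "'a \<Rightarrow> real" and M :: "('a, 'k) inf_path measure"
  assumes finite_paths: "finite_kgraph \<Lambda>"
    and pf_vec: "pf_vector \<Lambda> xL"
    and pf_meas: "pf_measure \<Lambda> xL M"
begin

section \<open>Finiteness and positivity of the eigenvalue data\<close>

lemma space_M: "space M = infinite_paths \<Lambda>"
  using pf_meas by (simp add: pf_measure_def)

lemma finite_measure_M: "finite_measure M"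
proof (rule finite_measureI)
  have "emeasure M (space M) = 1"
    using pf_meas unfolding pf_measure_def by blast
  then show "emeasure M (space M) \<noteq> \<infinity>"
    by simp
qed

lemma finite_vertices: "finite (vertices \<Lambda>)"
proof (rule finite_subset)
  show "vertices \<Lambda> \<subseteq> paths_of_degree \<Lambda> 0"
    by (auto simp: paths_of_degree_def vertexD deg_vertex)
  show "finite (paths_of_degree \<Lambda> 0)"
    using finite_paths by (simp add: finite_kgraph_def)
qed

lemma finite_D_paths: "finite (D_paths \<Lambda> v)"
proof (rule finite_subset)
  show "D_paths \<Lambda> v \<subseteq> paths_of_degree \<Lambda> (diag 1)"
    by (auto simp: paths_of_degree_def D_paths_def)
  show "finite (paths_of_degree \<Lambda> (diag 1 :: nat ^ 'k))"
    using finite_paths by (simp add: finite_kgraph_def)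
qed

lemma xL_pos: "v \<in> vertices \<Lambda> \<Longrightarrow> 0 < xL v"
  using pf_vec by (simp add: pf_vector_def)

text \<open>A probability measure cannot live on the empty set, so there is an infinite path; hence
  every vertex matrix has a nonzero entry and its eigenvalue on the positive vector is positive.\<close>

lemma rho_pos: "0 < rho \<Lambda> i"
proof -
  have "infinite_paths \<Lambda> \<noteq> {}"
    using pf_meas by (auto simp: pf_measure_def)
  then obtain x where x: "x \<in> infinite_paths \<Lambda>"
    by blast
  let ?e = "axis i 1 :: nat ^ 'k"
  let ?v = "x (0, 0)" and ?w = "x (?e, ?e)"
  note X = infinite_pathD[OF x vec_nat_zero_le, of ?e]
  have vw: "?v \<in> vertices \<Lambda>" "?w \<in> vertices \<Lambda>"
    using X(1-3) rng_vertex src_vertex by metis+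
  let ?P = "\<lambda>w. paths_between \<Lambda> ?v w \<inter> paths_of_degree \<Lambda> ?e"
  have "x (0, ?e) \<in> ?P ?w"
    using X(1-4) by (simp add: paths_between_def paths_of_degree_def vec_nat_diff_zero)
  moreover have "finite (?P ?w)"
    using finite_paths by (simp add: finite_kgraph_def)
  ultimately have "0 < vertex_matrix \<Lambda> i ?v ?w"
    unfolding vertex_matrix_def by (auto simp: card_gt_0_iff)
  then have "0 < real (vertex_matrix \<Lambda> i ?v ?w) * xL ?w"
    using xL_pos[OF vw(2)] by simp
  then have "0 < (\<Sum>w \<in> vertices \<Lambda>. real (vertex_matrix \<Lambda> i ?v w) * xL w)"
    using vw(2) finite_vertices xL_pos by (intro sum_pos2[of _ ?w]) (auto intro!: mult_nonneg_nonneg intro: less_imp_le)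
  also have "\<dots> = rho \<Lambda> i * xL ?v"
    using pf_vec vw(1) by (simp add: pf_vector_def)
  finally show ?thesis
    using xL_pos[OF vw(1)] by (simp add: zero_less_mult_iff)
qed

lemma rho_pow_pos: "0 < rho_pow \<Lambda> n"
  unfolding rho_pow_def by (intro prod_pos) (simp add: rho_pos)

lemma rho_pow_add: "rho_pow \<Lambda> (m + n) = rho_pow \<Lambda> m * rho_pow \<Lambda> n"
  by (simp add: rho_pow_def power_add prod.distrib)

lemma rho_pow_zero: "rho_pow \<Lambda> 0 = 1"
  by (simp add: rho_pow_def)

section \<open>Diagonal cylinders as generators of the Borel sets\<close>

definition diag_cylinders :: "('a, 'k) inf_path set set" where
  "diag_cylinders = insert {} {cylinder \<Lambda> \<eta> | \<eta>. \<eta> \<in> mor \<Lambda> \<and> (\<exists>n. deg \<Lambda> \<eta> = diag n)}"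

lemma diag_cylinders_sub: "diag_cylinders \<subseteq> Pow (space M)"
  by (auto simp: diag_cylinders_def space_M cylinder_def)

lemma diag_cylinders_Int_stable: "Int_stable diag_cylinders"
proof (rule Int_stableI)
  fix A B assume AB: "A \<in> diag_cylinders" "B \<in> diag_cylinders"
  show "A \<inter> B \<in> diag_cylinders"
  proof (cases "A = {} \<or> B = {}")
    case True
    then show ?thesis by (auto simp: diag_cylinders_def)
  next
    case False
    then obtain \<eta> \<mu> m n where A: "A = cylinder \<Lambda> \<eta>" "\<eta> \<in> mor \<Lambda>" "deg \<Lambda> \<eta> = diag m"
      and B: "B = cylinder \<Lambda> \<mu>" "\<mu> \<in> mor \<Lambda>" "deg \<Lambda> \<mu> = diag n"
      using AB unfolding diag_cylinders_def by blast
    have "deg \<Lambda> \<mu> \<le> deg \<Lambda> \<eta> \<or> deg \<Lambda> \<eta> \<le> deg \<Lambda> \<mu>"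
      unfolding A(3) B(3) using diag_mono nat_le_linear by blast
    then have "A \<inter> B = A \<or> A \<inter> B = B \<or> A \<inter> B = {}"
      using cylinder_cases[OF A(2) B(2)] cylinder_cases[OF B(2) A(2)] A(1) B(1) by blast
    then show ?thesis
      using AB by (auto simp: diag_cylinders_def)
  qed
qed

text \<open>Induction on the generation of the open set. The claim concerns all m from some n on,
  rather than a single level, so that two neighbourhoods can be intersected at a common level. For a
  basic set Z(\<eta>) every diagonal degree above d(\<eta>) works by
  \<open>cylinder_cases\<close>.\<close>

lemma open_contains_diag_cylinder:
  assumes "generate_topology_on (cylinder \<Lambda> ` mor \<Lambda>) U"
  shows "\<forall>x\<in>U. x \<in> infinite_paths \<Lambda> \<and> (\<exists>n. \<forall>m\<ge>n. cylinder \<Lambda> (x (0, diag m)) \<subseteq> U)"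
  using assms
proof induction
  case Empty
  then show ?case by simp
next
  case (Int a b)
  show ?case
  proof
    fix x assume "x \<in> a \<inter> b"
    then obtain n n' where "x \<in> infinite_paths \<Lambda>"
      "\<forall>m\<ge>n. cylinder \<Lambda> (x (0, diag m)) \<subseteq> a" "\<forall>m\<ge>n'. cylinder \<Lambda> (x (0, diag m)) \<subseteq> b"
      using Int by blast
    then show "x \<in> infinite_paths \<Lambda> \<and> (\<exists>n. \<forall>m\<ge>n. cylinder \<Lambda> (x (0, diag m)) \<subseteq> a \<inter> b)"
      by (intro conjI exI[of _ "max n n'"]) auto
  qed
next
  case (UN K)
  show ?case
  proof
    fix x assume "x \<in> \<Union>K"
    then obtain k where k: "k \<in> K" "x \<in> k" by blast
    then obtain n where "x \<in> infinite_paths \<Lambda>" "\<forall>m\<ge>n. cylinder \<Lambda> (x (0, diag m)) \<subseteq> k"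
      using UN.IH by blast
    then show "x \<in> infinite_paths \<Lambda> \<and> (\<exists>n. \<forall>m\<ge>n. cylinder \<Lambda> (x (0, diag m)) \<subseteq> \<Union>K)"
      using k(1) by (intro conjI exI[of _ n]) auto
  qed
next
  case (Basis s)
  then obtain \<eta> where \<eta>: "s = cylinder \<Lambda> \<eta>" "\<eta> \<in> mor \<Lambda>" by blast
  obtain n where n: "deg \<Lambda> \<eta> \<le> diag n"
    using le_diag_ex by blast
  show ?case
  proof
    fix x assume x: "x \<in> s"
    then have xi: "x \<in> infinite_paths \<Lambda>"
      by (simp add: \<eta> cylinder_def)
    have "cylinder \<Lambda> (x (0, diag m)) \<subseteq> s" if "m \<ge> n" for m
    proof -
      note X = infinite_pathD[OF xi vec_nat_zero_le, of "diag m"]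
      have "deg \<Lambda> \<eta> \<le> deg \<Lambda> (x (0, diag m))"
        using order_trans[OF n diag_mono[OF that]] X(4) by (simp add: vec_nat_diff_zero)
      moreover have "x \<in> cylinder \<Lambda> (x (0, diag m))"
        using xi X(4) by (simp add: cylinder_def vec_nat_diff_zero)
      ultimately show ?thesis
        using cylinder_cases[OF X(1) \<eta>(2)] x \<eta>(1) by blast
    qed
    then show "x \<in> infinite_paths \<Lambda> \<and> (\<exists>n. \<forall>m\<ge>n. cylinder \<Lambda> (x (0, diag m)) \<subseteq> s)"
      using xi by blast
  qed
qed

lemma openin_path_topology: "openin (path_topology \<Lambda>) U \<longleftrightarrow> generate_topology_on (cylinder \<Lambda> ` mor \<Lambda>) U"
  unfolding path_topology_def by (rule openin_topology_generated_by_iff)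

text \<open>Each point of an open set lies in a diagonal cylinder inside that set, and there are
  only countably many paths, so open sets are countable unions of diagonal cylinders.\<close>

lemma sets_M: "sets M = sigma_sets (space M) diag_cylinders"
proof -
  have "sigma_sets (infinite_paths \<Lambda>) {U. openin (path_topology \<Lambda>) U} = sigma_sets (infinite_paths \<Lambda>) diag_cylinders"
  proof (rule sigma_sets_eqI)
    fix U assume "U \<in> {U. openin (path_topology \<Lambda>) U}"
    then have g: "generate_topology_on (cylinder \<Lambda> ` mor \<Lambda>) U"
      by (simp add: openin_path_topology)
    let ?C = "{\<eta> \<in> mor \<Lambda>. (\<exists>n. deg \<Lambda> \<eta> = diag n) \<and> cylinder \<Lambda> \<eta> \<subseteq> U}"
    have "U = \<Union>(cylinder \<Lambda> ` ?C)"
    proof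
      show "U \<subseteq> \<Union>(cylinder \<Lambda> ` ?C)"
      proof
        fix x assume "x \<in> U"
        then obtain n where xi: "x \<in> infinite_paths \<Lambda>" and n: "cylinder \<Lambda> (x (0, diag n)) \<subseteq> U"
          using open_contains_diag_cylinder[OF g] by blast
        note X = infinite_pathD[OF xi vec_nat_zero_le, of "diag n"]
        have "x (0, diag n) \<in> ?C"
          using X(1,4) n by (auto simp: vec_nat_diff_zero)
        moreover have "x \<in> cylinder \<Lambda> (x (0, diag n))"
          using xi X(4) by (simp add: cylinder_def vec_nat_diff_zero)
        ultimately show "x \<in> \<Union>(cylinder \<Lambda> ` ?C)"
          by blast
      qed
    qed blast
    moreover have "\<Union>(cylinder \<Lambda> ` ?C) \<in> sigma_sets (infinite_paths \<Lambda>) diag_cylinders"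
    proof (rule sigma_sets_UNION)
      have "countable ?C"
        by (rule countable_subset[OF _ countable_mor]) blast
      then show "countable (cylinder \<Lambda> ` ?C)"
        by (rule countable_image)
      show "b \<in> sigma_sets (infinite_paths \<Lambda>) diag_cylinders" if "b \<in> cylinder \<Lambda> ` ?C" for b
        using that by (intro sigma_sets.Basic) (auto simp: diag_cylinders_def)
    qed
    ultimately show "U \<in> sigma_sets (infinite_paths \<Lambda>) diag_cylinders"
      by simp
  next
    fix A assume "A \<in> diag_cylinders"
    then have "openin (path_topology \<Lambda>) A"
      unfolding openin_path_topology diag_cylinders_def by (auto intro: generate_topology_on.intros)
    then show "A \<in> sigma_sets (infinite_paths \<Lambda>) {U. openin (path_topology \<Lambda>) U}"
      by (intro sigma_sets.Basic) simp
  qed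
  then show ?thesis
    using pf_meas by (simp add: pf_measure_def space_M)
qed

section \<open>The measure under the shift and the Radon-Nikodym derivative\<close>

lemma cylinder_sets [measurable]: "\<eta> \<in> mor \<Lambda> \<Longrightarrow> cylinder \<Lambda> \<eta> \<in> sets M"
  using pf_meas
  by (auto simp: pf_measure_def openin_path_topology intro!: sigma_sets.Basic generate_topology_on.Basis)

lemma measure_cylinder:
  "\<eta> \<in> mor \<Lambda> \<Longrightarrow> measure M (cylinder \<Lambda> \<eta>) = inverse (rho_pow \<Lambda> (deg \<Lambda> \<eta>)) * xL (src \<Lambda> \<eta>)"
  using pf_meas by (simp add: pf_measure_def)

lemma emeasure_cylinder:
  "\<eta> \<in> mor \<Lambda> \<Longrightarrow> emeasure M (cylinder \<Lambda> \<eta>) = ennreal (inverse (rho_pow \<Lambda> (deg \<Lambda> \<eta>)) * xL (src \<Lambda> \<eta>))"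
  using finite_measure.emeasure_eq_measure[OF finite_measure_M] measure_cylinder by simp

lemma cylinder_Int_space: "\<eta> \<in> mor \<Lambda> \<Longrightarrow> cylinder \<Lambda> \<eta> \<inter> space M \<in> sets M"
  by measurable

lemma space_restrict_cylinder: "space (restrict_space M (cylinder \<Lambda> \<eta>)) = cylinder \<Lambda> \<eta>"
  by (auto simp: space_restrict_space space_M cylinder_def)

lemma shift_vimage_cylinder:
  assumes "\<eta> \<in> mor \<Lambda>" "\<mu> \<in> mor \<Lambda>"
  shows "shift (deg \<Lambda> \<eta>) -` cylinder \<Lambda> \<mu> \<inter> cylinder \<Lambda> \<eta> =
    (if src \<Lambda> \<eta> = rng \<Lambda> \<mu> then cylinder \<Lambda> (cmp \<Lambda> \<eta> \<mu>) else {})"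
proof (cases "src \<Lambda> \<eta> = rng \<Lambda> \<mu>")
  case True
  then show ?thesis
    using cylinder_cmp_iff[OF assms] by auto
next
  case False
  have "src \<Lambda> \<eta> = rng \<Lambda> \<mu>" if "x \<in> cylinder \<Lambda> \<eta>" "shift (deg \<Lambda> \<eta>) x \<in> cylinder \<Lambda> \<mu>" for x
    using cylinderD(3)[OF that(2)] cylinderD(4)[OF that(1)] by (simp add: shift_apply)
  with False show ?thesis
    by auto
qed

lemma shift_measurable:
  assumes \<eta>: "\<eta> \<in> mor \<Lambda>"
  shows "shift (deg \<Lambda> \<eta>) \<in> measurable (restrict_space M (cylinder \<Lambda> \<eta>)) M"
proof (rule measurable_sigma_sets[OF sets_M diag_cylinders_sub])
  show "shift (deg \<Lambda> \<eta>) \<in> space (restrict_space M (cylinder \<Lambda> \<eta>)) \<rightarrow> space M"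
    using shift_infinite_path cylinderD(1) by (auto simp: space_restrict_cylinder space_M)
  fix A assume "A \<in> diag_cylinders"
  then show "shift (deg \<Lambda> \<eta>) -` A \<inter> space (restrict_space M (cylinder \<Lambda> \<eta>)) \<in> sets (restrict_space M (cylinder \<Lambda> \<eta>))"
    using shift_vimage_cylinder[OF \<eta>] cylinder_cmp_iff[OF \<eta>]
    by (auto simp: diag_cylinders_def space_restrict_cylinder
        sets_restrict_space_iff[OF cylinder_Int_space[OF \<eta>]] intro!: cylinder_sets cmp_closed \<eta>)
qed

text \<open>If r(\<mu>) = s(\<eta>), both measures give Z(\<mu>) the mass of Z(\<eta>\<mu>), because
  \<open>rho_pow\<close> is multiplicative and s(\<eta>\<mu>) = s(\<mu>); otherwise both give 0.
  Agreement on an intersection-stable generator suffices.\<close>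

lemma distr_shift:
  assumes \<eta>: "\<eta> \<in> mor \<Lambda>"
  shows "distr (restrict_space M (cylinder \<Lambda> \<eta>)) M (shift (deg \<Lambda> \<eta>)) =
    density M (\<lambda>x. ennreal (inverse (rho_pow \<Lambda> (deg \<Lambda> \<eta>))) * indicator (cylinder \<Lambda> (src \<Lambda> \<eta>)) x)"
    (is "?L = ?R")
proof (rule measure_eqI_generator_eq_countable[OF diag_cylinders_Int_stable diag_cylinders_sub])
  \<comment> \<open>The vertex cylinders have the diagonal degree 0, are finite in number and cover
    the space: the cover by generators of finite measure that the uniqueness theorem asks
    for.\<close>
  let ?A = "cylinder \<Lambda> ` vertices \<Lambda>"
  have s: "src \<Lambda> \<eta> \<in> vertices \<Lambda>"
    using \<eta> by (rule src_vertex)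
  have sm: "src \<Lambda> \<eta> \<in> mor \<Lambda>"
    using vertexD[OF s] by simp
  have L: "emeasure ?L X = emeasure M (shift (deg \<Lambda> \<eta>) -` X \<inter> cylinder \<Lambda> \<eta>)" if "X \<in> sets M" for X
    using that shift_measurable[OF \<eta>]
    by (simp add: emeasure_distr space_restrict_cylinder emeasure_restrict_space cylinder_Int_space[OF \<eta>])
  have R: "emeasure ?R X = ennreal (inverse (rho_pow \<Lambda> (deg \<Lambda> \<eta>))) * emeasure M (cylinder \<Lambda> (src \<Lambda> \<eta>) \<inter> X)"
    if "X \<in> sets M" for X
    using that cylinder_sets[OF sm]
    by (simp add: emeasure_density mult.assoc nn_integral_cmult indicator_inter_arith[symmetric] sets.Int)
  show "emeasure ?L X = emeasure ?R X" if X: "X \<in> diag_cylinders" for X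
  proof (cases "X = {}")
    case False
    then obtain \<mu> where \<mu>: "X = cylinder \<Lambda> \<mu>" "\<mu> \<in> mor \<Lambda>"
      using X by (auto simp: diag_cylinders_def)
    have Xs: "X \<in> sets M"
      using \<mu> by (simp add: cylinder_sets)
    show ?thesis
    proof (cases "src \<Lambda> \<eta> = rng \<Lambda> \<mu>")
      case True
      have "cylinder \<Lambda> (src \<Lambda> \<eta>) \<inter> X = X"
        using cylinderD(1,3) deg_vertex[OF s] True unfolding \<mu>(1) by (auto simp: cylinder_def)
      then have "emeasure ?R X = ennreal (inverse (rho_pow \<Lambda> (deg \<Lambda> \<eta>)) * (inverse (rho_pow \<Lambda> (deg \<Lambda> \<mu>)) * xL (src \<Lambda> \<mu>)))"
        using R[OF Xs] emeasure_cylinder[OF \<mu>(2)] \<mu>(1)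
          rho_pow_pos[of "deg \<Lambda> \<eta>"] rho_pow_pos[of "deg \<Lambda> \<mu>"] xL_pos[OF src_vertex[OF \<mu>(2)]]
        by (simp add: ennreal_mult)
      also have "\<dots> = emeasure M (cylinder \<Lambda> (cmp \<Lambda> \<eta> \<mu>))"
        using \<eta> \<mu>(2) True
        by (simp add: emeasure_cylinder cmp_closed deg_cmp src_cmp rho_pow_add mult.assoc)
      also have "\<dots> = emeasure ?L X"
        using L[OF Xs] shift_vimage_cylinder[OF \<eta> \<mu>(2)] True \<mu>(1) by simp
      finally show ?thesis by simp
    next
      case False
      have "cylinder \<Lambda> (src \<Lambda> \<eta>) \<inter> X = {}"
        using cylinderD(3) vertexD[OF s] False unfolding \<mu>(1) by fastforce
      then show ?thesis
        using L[OF Xs] R[OF Xs] shift_vimage_cylinder[OF \<eta> \<mu>(2)] False \<mu>(1) by simp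
    qed
  qed simp
  show "sets ?L = sigma_sets (space M) diag_cylinders" "sets ?R = sigma_sets (space M) diag_cylinders"
    by (simp_all add: sets_M)
  show "?A \<subseteq> diag_cylinders"
    using vertexD(1) deg_vertex by (auto simp: diag_cylinders_def intro!: exI[of _ 0] simp flip: diag_zero)
  show "\<Union>?A = space M"
  proof
    show "\<Union>?A \<subseteq> space M"
      by (auto simp: cylinder_def space_M)
    show "space M \<subseteq> \<Union>?A"
    proof
      fix x assume "x \<in> space M"
      then have x: "x \<in> infinite_paths \<Lambda>" by (simp add: space_M)
      have v: "x (0, 0) \<in> vertices \<Lambda>"
        using infinite_pathD(1,2)[OF x, of 0 0] rng_vertex by force
      then have "x \<in> cylinder \<Lambda> (x (0, 0))"
        using x by (simp add: cylinder_def deg_vertex)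
      with v show "x \<in> \<Union>?A"
        by blast
    qed
  qed
  show "countable ?A"
    using finite_vertices by (simp add: countable_finite)
  fix a assume "a \<in> ?A"
  then have a: "a \<in> sets M"
    using vertexD(1) cylinder_sets by auto
  have "emeasure ?L a = emeasure M (shift (deg \<Lambda> \<eta>) -` a \<inter> cylinder \<Lambda> \<eta>)"
    by (rule L[OF a])
  then show "emeasure ?L a \<noteq> \<infinity>"
    using finite_measure.emeasure_finite[OF finite_measure_M] by simp
qed

text \<open>By \<open>prefix_map_image\<close> the value on A is the pushforward of M under the
  shift on Z(\<eta>), and \<open>distr_shift\<close> makes that a constant multiple of M on
  Z(s(\<eta>)).\<close>

lemma pulled_back_measure_eq:
  assumes \<eta>: "\<eta> \<in> mor \<Lambda>"
  shows "pulled_back_measure \<Lambda> M \<eta> =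
    density (restrict_space M (cylinder \<Lambda> (src \<Lambda> \<eta>))) (\<lambda>_. ennreal (inverse (rho_pow \<Lambda> (deg \<Lambda> \<eta>))))"
    (is "_ = density ?N (\<lambda>_. ?c)")
proof -
  let ?Z = "cylinder \<Lambda> (src \<Lambda> \<eta>)"
  have sm: "src \<Lambda> \<eta> \<in> mor \<Lambda>"
    using vertexD[OF src_vertex[OF \<eta>]] by simp
  have eq: "emeasure M (prefix_map \<Lambda> \<eta> ` A) = emeasure (density ?N (\<lambda>_. ?c)) A" if A: "A \<in> sets ?N" for A
  proof -
    have A': "A \<subseteq> ?Z" "A \<in> sets M"
      using A by (auto simp: sets_restrict_space_iff[OF cylinder_Int_space[OF sm]])
    have "emeasure M (prefix_map \<Lambda> \<eta> ` A) = emeasure M (shift (deg \<Lambda> \<eta>) -` A \<inter> cylinder \<Lambda> \<eta>)"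
      unfolding prefix_map_image[OF \<eta> A'(1)] by (rule arg_cong[of _ _ "emeasure M"]) auto
    also have "\<dots> = emeasure (distr (restrict_space M (cylinder \<Lambda> \<eta>)) M (shift (deg \<Lambda> \<eta>))) A"
      using A'(2) shift_measurable[OF \<eta>]
      by (simp add: emeasure_distr space_restrict_cylinder emeasure_restrict_space cylinder_Int_space[OF \<eta>])
    also have "\<dots> = ?c * emeasure M (?Z \<inter> A)"
      unfolding distr_shift[OF \<eta>] using A'(2) cylinder_sets[OF sm]
      by (simp add: emeasure_density mult.assoc nn_integral_cmult indicator_inter_arith[symmetric] sets.Int)
    also have "?Z \<inter> A = A"
      using A'(1) by blast
    also have "?c * emeasure M A = emeasure (density ?N (\<lambda>_. ?c)) A"
      using A A'(1) by (simp add: emeasure_density_const emeasure_restrict_space cylinder_Int_space[OF sm])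
    finally show ?thesis .
  qed
  \<comment> \<open>Only values on the generated sigma-algebra matter to \<open>measure_of\<close>,
    so the raw set function can be exchanged for the density, which is already a measure.\<close>
  have "pulled_back_measure \<Lambda> M \<eta> = measure_of ?Z (sets ?N) (emeasure (density ?N (\<lambda>_. ?c)))"
    unfolding pulled_back_measure_def Let_def
  proof (rule measure_of_eq)
    show "sets ?N \<subseteq> Pow ?Z"
      using sets.space_closed[of ?N] by (simp add: space_restrict_cylinder)
    fix a assume "a \<in> sigma_sets ?Z (sets ?N)"
    then have "a \<in> sets ?N"
      using sets.sigma_sets_eq[of ?N] by (simp add: space_restrict_cylinder)
    then show "emeasure M (prefix_map \<Lambda> \<eta> ` a) = emeasure (density ?N (\<lambda>_. ?c)) a"
      by (rule eq)
  qed
  also have "\<dots> = density ?N (\<lambda>_. ?c)"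
    using measure_of_of_measure[of "density ?N (\<lambda>_. ?c)"] by (simp add: space_restrict_cylinder)
  finally show ?thesis .
qed

text \<open>Uniqueness of the derivative gives the constant almost everywhere on Z(s(\<eta>)), but
  \<open>S_op\<close> evaluates it at the shifted point. Preimages of null sets stay null because
  \<open>distr_shift\<close> bounds the pushforward by a multiple of M.\<close>

lemma RN_prefix_AE:
  assumes \<eta>: "\<eta> \<in> mor \<Lambda>"
  shows "AE x in M. x \<in> cylinder \<Lambda> \<eta> \<longrightarrow>
    RN_prefix \<Lambda> M \<eta> (shift (deg \<Lambda> \<eta>) x) = inverse (rho_pow \<Lambda> (deg \<Lambda> \<eta>))"
proof -
  let ?Z = "cylinder \<Lambda> (src \<Lambda> \<eta>)" and ?c = "inverse (rho_pow \<Lambda> (deg \<Lambda> \<eta>))"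
  have c: "0 < ?c"
    using rho_pow_pos by simp
  have sm: "src \<Lambda> \<eta> \<in> mor \<Lambda>"
    using vertexD[OF src_vertex[OF \<eta>]] by simp
  interpret N: finite_measure "restrict_space M ?Z"
    by (rule finite_measure_restrict_space[OF finite_measure_M cylinder_sets[OF sm]])
  have "AE x in restrict_space M ?Z. ennreal ?c = RN_deriv (restrict_space M ?Z) (pulled_back_measure \<Lambda> M \<eta>) x"
    by (rule N.RN_deriv_unique) (simp_all add: pulled_back_measure_eq[OF \<eta>])
  then have "AE x in restrict_space M ?Z. RN_prefix \<Lambda> M \<eta> x = ?c"
  proof eventually_elim
    case (elim x)
    then show ?case
      using c unfolding RN_prefix_def by (metis enn2real_ennreal less_imp_le)
  qed
  then have "AE x in M. x \<in> ?Z \<longrightarrow> RN_prefix \<Lambda> M \<eta> x = ?c"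
    by (simp add: AE_restrict_space_iff cylinder_Int_space[OF sm])
  \<comment> \<open>The density vanishes off Z(s(\<eta>)), so the condition of lying in that
    cylinder is absorbed before the statement is carried along the shift.\<close>
  then have "AE x in density M (\<lambda>x. ennreal ?c * indicator ?Z x). RN_prefix \<Lambda> M \<eta> x = ?c"
    using cylinder_sets[OF sm] by (subst AE_density) (auto simp: indicator_def elim: eventually_mono)
  then have "AE x in distr (restrict_space M (cylinder \<Lambda> \<eta>)) M (shift (deg \<Lambda> \<eta>)). RN_prefix \<Lambda> M \<eta> x = ?c"
    unfolding distr_shift[OF \<eta>] .
  then have "AE x in restrict_space M (cylinder \<Lambda> \<eta>). RN_prefix \<Lambda> M \<eta> (shift (deg \<Lambda> \<eta>) x) = ?c"
    by (rule AE_distrD[OF shift_measurable[OF \<eta>]])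
  then show ?thesis
    by (simp add: AE_restrict_space_iff cylinder_Int_space[OF \<eta>])
qed

text \<open>Measurability of \<open>RN_prefix\<close> is available on Z(s(\<eta>)), into which the
  shift maps Z(\<eta>). The product is therefore measurable on Z(\<eta>) and is extended by
  zero.\<close>

lemma S_op_measurable:
  assumes \<eta>: "\<eta> \<in> mor \<Lambda>" and \<xi>: "\<xi> \<in> borel_measurable M"
  shows "S_op \<Lambda> M \<eta> \<xi> \<in> borel_measurable M"
proof -
  let ?Z = "cylinder \<Lambda> (src \<Lambda> \<eta>)" and ?E = "restrict_space M (cylinder \<Lambda> \<eta>)"
  have [measurable]: "shift (deg \<Lambda> \<eta>) \<in> measurable ?E (restrict_space M ?Z)"
    using shift_cylinder
    by (intro measurable_restrict_space2 shift_measurable[OF \<eta>]) (auto simp: space_restrict_cylinder)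
  have [measurable]: "RN_prefix \<Lambda> M \<eta> \<in> borel_measurable (restrict_space M ?Z)"
    unfolding RN_prefix_def by measurable
  have [measurable]: "\<xi> \<in> borel_measurable (restrict_space M ?Z)"
    by (rule measurable_restrict_space1[OF \<xi>])
  have "(\<lambda>x. complex_of_real (RN_prefix \<Lambda> M \<eta> (shift (deg \<Lambda> \<eta>) x) powr (- 1 / 2)) *
      \<xi> (shift (deg \<Lambda> \<eta>) x)) \<in> borel_measurable ?E"
    by measurable
  then have "(\<lambda>x. indicator (cylinder \<Lambda> \<eta>) x *\<^sub>R (complex_of_real (RN_prefix \<Lambda> M \<eta> (shift (deg \<Lambda> \<eta>) x) powr (- 1 / 2)) *
      \<xi> (shift (deg \<Lambda> \<eta>) x))) \<in> borel_measurable M"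
    by (simp add: borel_measurable_restrict_space_iff[OF cylinder_Int_space[OF \<eta>]])
  also have "(\<lambda>x. indicator (cylinder \<Lambda> \<eta>) x *\<^sub>R (complex_of_real (RN_prefix \<Lambda> M \<eta> (shift (deg \<Lambda> \<eta>) x) powr (- 1 / 2)) *
      \<xi> (shift (deg \<Lambda> \<eta>) x))) = S_op \<Lambda> M \<eta> \<xi>"
    by (auto simp: fun_eq_iff S_op_def indicator_def)
  finally show ?thesis .
qed

section \<open>The wavelet decomposition\<close>

lemma Theta_measurable: "\<eta> \<in> mor \<Lambda> \<Longrightarrow> Theta \<Lambda> \<eta> \<in> borel_measurable M"
  unfolding Theta_def by (intro borel_measurable_indicator cylinder_sets)

lemma Theta_L2: "\<eta> \<in> mor \<Lambda> \<Longrightarrow> Theta \<Lambda> \<eta> \<in> L2 M"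
  by (rule L2_bounded[OF finite_measure_M Theta_measurable, where B = 1]) (auto simp: Theta_def indicator_def)

lemma L2_inner_Theta:
  assumes "\<eta> \<in> mor \<Lambda>" "\<mu> \<in> mor \<Lambda>"
  shows "L2_inner M (Theta \<Lambda> \<eta>) (Theta \<Lambda> \<mu>) = complex_of_real (measure M (cylinder \<Lambda> \<eta> \<inter> cylinder \<Lambda> \<mu>))"
proof -
  have "L2_inner M (Theta \<Lambda> \<eta>) (Theta \<Lambda> \<mu>) = (\<integral>x. complex_of_real (indicator (cylinder \<Lambda> \<eta> \<inter> cylinder \<Lambda> \<mu>) x) \<partial>M)"
    unfolding L2_inner_def
    by (rule Bochner_Integration.integral_cong) (auto simp: Theta_def indicator_def)
  also have "\<dots> = complex_of_real (\<integral>x. indicator (cylinder \<Lambda> \<eta> \<inter> cylinder \<Lambda> \<mu>) x \<partial>M)"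
    by (rule integral_complex_of_real)
  also have "\<dots> = complex_of_real (measure M (cylinder \<Lambda> \<eta> \<inter> cylinder \<Lambda> \<mu>))"
    using assms cylinder_sets sets.sets_into_space by (subst Bochner_Integration.integral_indicator) (auto simp: Int_absorb2)
  finally show ?thesis .
qed

text \<open>The representative of \<open>S_op \<Lambda> M \<eta> (wavelet \<Lambda> c m (src \<Lambda> \<eta>))\<close> obtained by replacing the
  Radon-Nikodym derivative by its constant value.\<close>

definition psi :: "(nat \<Rightarrow> 'a \<Rightarrow> 'a \<Rightarrow> complex) \<Rightarrow> 'a \<Rightarrow> nat \<Rightarrow> ('a, 'k) inf_path \<Rightarrow> complex" where
  "psi c \<eta> m x = (\<Sum>l \<in> D_paths \<Lambda> (src \<Lambda> \<eta>).
     (complex_of_real (sqrt (rho_pow \<Lambda> (deg \<Lambda> \<eta>))) * c m (src \<Lambda> \<eta>) l) * Theta \<Lambda> (cmp \<Lambda> \<eta> l) x)"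

lemma cmp_D_paths:
  assumes "\<eta> \<in> mor \<Lambda>" "l \<in> D_paths \<Lambda> (src \<Lambda> \<eta>)"
  shows "cmp \<Lambda> \<eta> l \<in> mor \<Lambda>" "deg \<Lambda> (cmp \<Lambda> \<eta> l) = deg \<Lambda> \<eta> + diag 1" "src \<Lambda> (cmp \<Lambda> \<eta> l) = src \<Lambda> l"
    "cylinder \<Lambda> (cmp \<Lambda> \<eta> l) \<subseteq> cylinder \<Lambda> \<eta>"
  using assms D_pathsD[OF assms(2)] cmp_closed deg_cmp src_cmp cylinder_cmp_iff by auto

lemma D_paths_disjoint:
  assumes \<eta>: "\<eta> \<in> mor \<Lambda>" and l: "l \<in> D_paths \<Lambda> (src \<Lambda> \<eta>)" "l' \<in> D_paths \<Lambda> (src \<Lambda> \<eta>)" and "l \<noteq> l'"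
  shows "cylinder \<Lambda> (cmp \<Lambda> \<eta> l) \<inter> cylinder \<Lambda> (cmp \<Lambda> \<eta> l') = {}"
proof (rule cylinder_disjoint)
  show "deg \<Lambda> (cmp \<Lambda> \<eta> l) = deg \<Lambda> (cmp \<Lambda> \<eta> l')"
    by (simp only: cmp_D_paths(2)[OF \<eta> l(1)] cmp_D_paths(2)[OF \<eta> l(2)])
  show "cmp \<Lambda> \<eta> l \<noteq> cmp \<Lambda> \<eta> l'"
  proof
    assume "cmp \<Lambda> \<eta> l = cmp \<Lambda> \<eta> l'"
    then have "l = l'"
      by (rule factorization_unique(2)[OF \<eta> D_pathsD(1)[OF l(1)] D_pathsD(3)[OF l(1), symmetric]
            \<eta> D_pathsD(1)[OF l(2)] D_pathsD(3)[OF l(2), symmetric] _ refl])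
    with \<open>l \<noteq> l'\<close> show False ..
  qed
qed

lemma psi_L2: "\<eta> \<in> mor \<Lambda> \<Longrightarrow> psi c \<eta> m \<in> L2 M"
  unfolding psi_def by (intro L2_sum L2_cmult Theta_L2 cmp_D_paths)

lemma psi_outside: "\<eta> \<in> mor \<Lambda> \<Longrightarrow> x \<notin> cylinder \<Lambda> \<eta> \<Longrightarrow> psi c \<eta> m x = 0"
  unfolding psi_def using cmp_D_paths(4)[of \<eta>]
  by (intro sum.neutral ballI) (auto simp: Theta_def indicator_def subset_iff)

lemma psi_eq_shift:
  assumes \<eta>: "\<eta> \<in> mor \<Lambda>" and x: "x \<in> cylinder \<Lambda> \<eta>"
  shows "psi c \<eta> m x = complex_of_real (sqrt (rho_pow \<Lambda> (deg \<Lambda> \<eta>))) * wavelet \<Lambda> c m (src \<Lambda> \<eta>) (shift (deg \<Lambda> \<eta>) x)"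
proof -
  have "Theta \<Lambda> (cmp \<Lambda> \<eta> l) x = Theta \<Lambda> l (shift (deg \<Lambda> \<eta>) x)" if "l \<in> D_paths \<Lambda> (src \<Lambda> \<eta>)" for l
    using cylinder_cmp_iff[OF \<eta>, of l x] D_pathsD[OF that] x by (simp add: Theta_def indicator_def)
  then show ?thesis
    by (simp add: psi_def wavelet_def sum_distrib_left mult.assoc)
qed

lemma wavelet_measurable: "wavelet \<Lambda> c m v \<in> borel_measurable M"
  unfolding wavelet_def
  by (intro borel_measurable_sum borel_measurable_times borel_measurable_const Theta_measurable D_pathsD)

lemma S_op_wavelet_AE:
  assumes \<eta>: "\<eta> \<in> mor \<Lambda>"
  shows "AE x in M. S_op \<Lambda> M \<eta> (wavelet \<Lambda> c m (src \<Lambda> \<eta>)) x = psi c \<eta> m x"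
  using RN_prefix_AE[OF \<eta>]
proof eventually_elim
  case (elim x)
  show ?case
  proof (cases "x \<in> cylinder \<Lambda> \<eta>")
    case True
    have "inverse (rho_pow \<Lambda> (deg \<Lambda> \<eta>)) powr (- 1 / 2) = sqrt (rho_pow \<Lambda> (deg \<Lambda> \<eta>))"
      using rho_pow_pos[of "deg \<Lambda> \<eta>"]
      by (simp add: powr_minus powr_half_sqrt real_sqrt_inverse flip: powr_minus_divide)
    then show ?thesis
      using True elim psi_eq_shift[OF \<eta> True] by (simp add: S_op_def)
  qed (simp add: psi_outside[OF \<eta>] S_op_def)
qed

lemma S_op_wavelet_L2: "\<eta> \<in> mor \<Lambda> \<Longrightarrow> S_op \<Lambda> M \<eta> (wavelet \<Lambda> c m (src \<Lambda> \<eta>)) \<in> L2 M"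
  using S_op_wavelet_AE[of \<eta> c m]
  by (intro L2_cong_AE[OF psi_L2[of \<eta> c m]] S_op_measurable wavelet_measurable) (auto elim: eventually_mono)

lemma L2_inner_S_op:
  assumes "\<eta> \<in> mor \<Lambda>" "\<mu> \<in> mor \<Lambda>"
  shows "L2_inner M (S_op \<Lambda> M \<eta> (wavelet \<Lambda> c m (src \<Lambda> \<eta>))) (S_op \<Lambda> M \<mu> (wavelet \<Lambda> c m' (src \<Lambda> \<mu>))) =
    L2_inner M (psi c \<eta> m) (psi c \<mu> m')"
  using assms
  by (intro L2_inner_cong_AE S_op_measurable wavelet_measurable L2_meas[OF psi_L2] S_op_wavelet_AE)

text \<open>For a vertex the normalizing factor is 1 and prefixing changes nothing; level 0 can thus
  be treated like the positive levels.\<close>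

lemma psi_vertex:
  assumes "v \<in> vertices \<Lambda>"
  shows "psi c v m = wavelet \<Lambda> c m v"
proof
  fix x
  have "cmp \<Lambda> v l = l" if "l \<in> D_paths \<Lambda> v" for l
    using cmp_rng D_pathsD[OF that] by metis
  then show "psi c v m x = wavelet \<Lambda> c m v x"
    using assms by (simp add: psi_def wavelet_def vertexD deg_vertex rho_pow_zero)
qed

text \<open>At a lower level the function combines indicators of cylinders Z(\<mu>l) that contain
  Z(\<eta>) or miss it. At the same level it vanishes off Z(\<mu>), which is disjoint from
  Z(\<eta>).\<close>

lemma psi_constant:
  assumes \<eta>: "\<eta> \<in> mor \<Lambda>" "deg \<Lambda> \<eta> = diag j" and \<mu>: "\<mu> \<in> mor \<Lambda>" "deg \<Lambda> \<mu> = diag i"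
    and "i < j \<or> i = j \<and> \<mu> \<noteq> \<eta>"
  shows "\<exists>k. \<forall>x\<in>cylinder \<Lambda> \<eta>. psi c \<mu> m x = k"
proof (cases "i < j")
  case True
  have "\<exists>k. \<forall>x\<in>cylinder \<Lambda> \<eta>. Theta \<Lambda> (cmp \<Lambda> \<mu> l) x = k" if l: "l \<in> D_paths \<Lambda> (src \<Lambda> \<mu>)" for l
  proof -
    \<comment> \<open>The paths \<mu>l lie one level above \<mu>; the strict inequality i < j leaves
      just enough room.\<close>
    have "(diag (i + 1) :: nat ^ 'k) \<le> diag j"
      using True by (intro diag_mono) simp
    then have "deg \<Lambda> (cmp \<Lambda> \<mu> l) \<le> deg \<Lambda> \<eta>"
      by (simp only: cmp_D_paths(2)[OF \<mu>(1) l] \<eta>(2) \<mu>(2) diag_add)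
    then have "cylinder \<Lambda> \<eta> \<subseteq> cylinder \<Lambda> (cmp \<Lambda> \<mu> l) \<or> cylinder \<Lambda> \<eta> \<inter> cylinder \<Lambda> (cmp \<Lambda> \<mu> l) = {}"
      by (intro cylinder_cases \<eta>(1) cmp_D_paths(1)[OF \<mu>(1) l])
    then show ?thesis
    proof
      assume "cylinder \<Lambda> \<eta> \<subseteq> cylinder \<Lambda> (cmp \<Lambda> \<mu> l)"
      then show ?thesis by (intro exI[of _ 1]) (auto simp: Theta_def)
    next
      assume "cylinder \<Lambda> \<eta> \<inter> cylinder \<Lambda> (cmp \<Lambda> \<mu> l) = {}"
      then show ?thesis by (intro exI[of _ 0]) (auto simp: Theta_def indicator_def)
    qed
  qed
  then obtain k where "\<And>l x. l \<in> D_paths \<Lambda> (src \<Lambda> \<mu>) \<Longrightarrow> x \<in> cylinder \<Lambda> \<eta> \<Longrightarrow> Theta \<Lambda> (cmp \<Lambda> \<mu> l) x = k l"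
    by metis
  then show ?thesis
    unfolding psi_def
    by (intro exI[of _ "\<Sum>l \<in> D_paths \<Lambda> (src \<Lambda> \<mu>).
     (complex_of_real (sqrt (rho_pow \<Lambda> (deg \<Lambda> \<mu>))) * c m (src \<Lambda> \<mu>) l) * k l"] ballI sum.cong) auto
next
  case False
  then have "cylinder \<Lambda> \<eta> \<inter> cylinder \<Lambda> \<mu> = {}"
    using assms by (intro cylinder_disjoint) auto
  then show ?thesis
    using psi_outside[OF \<mu>(1)] by (intro exI[of _ 0]) auto
qed

end

locale pf_wavelets = pf_kgraph \<Lambda> xL M for \<Lambda> :: "('a, 'k::finite) kgraph" and xL M +
  fixes c :: "nat \<Rightarrow> 'a \<Rightarrow> 'a \<Rightarrow> complex"
  assumes coeffs: "wavelet_coeffs \<Lambda> xL c"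
begin

section \<open>Orthogonality relations for prefixed wavelets\<close>

lemma coeffs_sum_zero:
  "v \<in> vertices \<Lambda> \<Longrightarrow> m \<in> wavelet_indices \<Lambda> v \<Longrightarrow> D_inner \<Lambda> xL v (\<lambda>_. 1) (c m v) = 0"
  using coeffs unfolding wavelet_coeffs_def by blast

lemma coeffs_orthonormal:
  "v \<in> vertices \<Lambda> \<Longrightarrow> m \<in> wavelet_indices \<Lambda> v \<Longrightarrow> m' \<in> wavelet_indices \<Lambda> v \<Longrightarrow>
    D_inner \<Lambda> xL v (c m v) (c m' v) = (if m = m' then 1 else 0)"
  using coeffs unfolding wavelet_coeffs_def by blast

lemma coeffs_span:
  assumes "v \<in> vertices \<Lambda>" "D_inner \<Lambda> xL v (\<lambda>_. 1) u = 0"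
  shows "\<exists>a. \<forall>l \<in> D_paths \<Lambda> v. u l = (\<Sum>m \<in> wavelet_indices \<Lambda> v. a m * c m v l)"
  using coeffs assms unfolding wavelet_coeffs_def by blast

lemma measure_cmp_D_paths:
  assumes "\<eta> \<in> mor \<Lambda>" "l \<in> D_paths \<Lambda> (src \<Lambda> \<eta>)"
  shows "measure M (cylinder \<Lambda> (cmp \<Lambda> \<eta> l)) =
    inverse (rho_pow \<Lambda> (deg \<Lambda> \<eta>)) * (inverse (rho_pow \<Lambda> (diag 1)) * xL (src \<Lambda> l))"
  using cmp_D_paths[OF assms] by (simp add: measure_cylinder rho_pow_add)

text \<open>The integral of \<open>psi c \<eta> m\<close> over Z(\<eta>) is a multiple of the inner
  product of the coefficients with (1, ..., 1), hence zero. Allowing any g constant on Z(\<eta>)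
  covers other paths of the same level, lower levels and \<open>V0\<close> at once.\<close>

lemma psi_orthogonal:
  assumes \<eta>: "\<eta> \<in> mor \<Lambda>" and m: "m \<in> wavelet_indices \<Lambda> (src \<Lambda> \<eta>)"
    and g: "\<exists>k. \<forall>x\<in>cylinder \<Lambda> \<eta>. g x = k"
  shows "L2_inner M (psi c \<eta> m) g = 0"
proof -
  obtain k where k: "\<And>x. x \<in> cylinder \<Lambda> \<eta> \<Longrightarrow> g x = k"
    using g by blast
  let ?v = "src \<Lambda> \<eta>" and ?s = "complex_of_real (sqrt (rho_pow \<Lambda> (deg \<Lambda> \<eta>)))"
    and ?r = "complex_of_real (inverse (rho_pow \<Lambda> (deg \<Lambda> \<eta>)))"
  have "L2_inner M (psi c \<eta> m) g = (\<integral>x. cnj k * (psi c \<eta> m x * cnj (Theta \<Lambda> \<eta> x)) \<partial>M)"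
    unfolding L2_inner_def
  proof (rule Bochner_Integration.integral_cong)
    show "psi c \<eta> m x * cnj (g x) = cnj k * (psi c \<eta> m x * cnj (Theta \<Lambda> \<eta> x))" for x
      using k psi_outside[OF \<eta>] by (cases "x \<in> cylinder \<Lambda> \<eta>") (auto simp: Theta_def)
  qed simp
  also have "\<dots> = cnj k * L2_inner M (psi c \<eta> m) (Theta \<Lambda> \<eta>)"
    by (simp add: L2_inner_def)
  also have "L2_inner M (psi c \<eta> m) (Theta \<Lambda> \<eta>) =
      (\<Sum>l \<in> D_paths \<Lambda> ?v. (?s * c m ?v l) * L2_inner M (Theta \<Lambda> (cmp \<Lambda> \<eta> l)) (Theta \<Lambda> \<eta>))"
    unfolding psi_def using \<eta> by (intro L2_inner_sum_left Theta_L2 cmp_D_paths)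
  also have "\<dots> = (\<Sum>l \<in> D_paths \<Lambda> ?v. ?s * ?r *
      (cnj 1 * c m ?v l * complex_of_real (inverse (rho_pow \<Lambda> (diag 1)) * xL (src \<Lambda> l))))"
  proof (rule sum.cong[OF refl])
    fix l assume l: "l \<in> D_paths \<Lambda> ?v"
    show "(?s * c m ?v l) * L2_inner M (Theta \<Lambda> (cmp \<Lambda> \<eta> l)) (Theta \<Lambda> \<eta>) =
      ?s * ?r * (cnj 1 * c m ?v l * complex_of_real (inverse (rho_pow \<Lambda> (diag 1)) * xL (src \<Lambda> l)))"
      using L2_inner_Theta[OF cmp_D_paths(1)[OF \<eta> l] \<eta>] cmp_D_paths(4)[OF \<eta> l] measure_cmp_D_paths[OF \<eta> l]
      by (simp add: Int_absorb2)
  qed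
  also have "\<dots> = ?s * ?r * D_inner \<Lambda> xL ?v (\<lambda>_. 1) (c m ?v)"
    by (simp only: D_inner_def sum_distrib_left)
  also have "\<dots> = 0"
    using coeffs_sum_zero[OF src_vertex[OF \<eta>] m] by simp
  finally show ?thesis by simp
qed

text \<open>The square of the normalizing factor cancels the power of rho in the measures of the
  disjoint cylinders Z(\<eta>l), and exactly \<open>D_inner\<close> is left.\<close>

lemma psi_orthonormal:
  assumes \<eta>: "\<eta> \<in> mor \<Lambda>" and m: "m \<in> wavelet_indices \<Lambda> (src \<Lambda> \<eta>)" "m' \<in> wavelet_indices \<Lambda> (src \<Lambda> \<eta>)"
  shows "L2_inner M (psi c \<eta> m) (psi c \<eta> m') = (if m = m' then 1 else 0)"
proof -
  let ?v = "src \<Lambda> \<eta>" and ?s = "complex_of_real (sqrt (rho_pow \<Lambda> (deg \<Lambda> \<eta>)))"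
  let ?D = "D_paths \<Lambda> ?v" and ?r = "rho_pow \<Lambda> (deg \<Lambda> \<eta>)"
  have L: "Theta \<Lambda> (cmp \<Lambda> \<eta> l) \<in> L2 M" if "l \<in> ?D" for l
    using that \<eta> by (intro Theta_L2 cmp_D_paths)
  have "L2_inner M (psi c \<eta> m) (psi c \<eta> m') =
      (\<Sum>l\<in>?D. (?s * c m ?v l) * L2_inner M (Theta \<Lambda> (cmp \<Lambda> \<eta> l)) (psi c \<eta> m'))"
    unfolding psi_def[of c \<eta> m] by (rule L2_inner_sum_left[OF L psi_L2[OF \<eta>]])
  also have "\<dots> = (\<Sum>l\<in>?D. cnj (c m' ?v l) * c m ?v l * complex_of_real (inverse (rho_pow \<Lambda> (diag 1)) * xL (src \<Lambda> l)))"
  proof (rule sum.cong[OF refl])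
    fix l assume l: "l \<in> ?D"
    let ?w = "complex_of_real (inverse (rho_pow \<Lambda> (diag 1)) * xL (src \<Lambda> l))"
    have "L2_inner M (Theta \<Lambda> (cmp \<Lambda> \<eta> l)) (psi c \<eta> m') =
        (\<Sum>l'\<in>?D. cnj (?s * c m' ?v l') * L2_inner M (Theta \<Lambda> (cmp \<Lambda> \<eta> l)) (Theta \<Lambda> (cmp \<Lambda> \<eta> l')))"
      unfolding psi_def[of c \<eta> m'] by (rule L2_inner_sum_right[OF L L[OF l]])
    also have "\<dots> = (\<Sum>l'\<in>?D. if l' = l then cnj (?s * c m' ?v l) * complex_of_real (measure M (cylinder \<Lambda> (cmp \<Lambda> \<eta> l))) else 0)"
    proof (rule sum.cong[OF refl])
      fix l' assume l': "l' \<in> ?D"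
      have "cylinder \<Lambda> (cmp \<Lambda> \<eta> l) \<inter> cylinder \<Lambda> (cmp \<Lambda> \<eta> l') = {}" if "l' \<noteq> l"
        using D_paths_disjoint[OF \<eta> l l'] that by blast
      then show "cnj (?s * c m' ?v l') * L2_inner M (Theta \<Lambda> (cmp \<Lambda> \<eta> l)) (Theta \<Lambda> (cmp \<Lambda> \<eta> l')) =
        (if l' = l then cnj (?s * c m' ?v l) * complex_of_real (measure M (cylinder \<Lambda> (cmp \<Lambda> \<eta> l))) else 0)"
        using L2_inner_Theta[OF cmp_D_paths(1)[OF \<eta> l] cmp_D_paths(1)[OF \<eta> l']] by simp
    qed
    also have "\<dots> = cnj (?s * c m' ?v l) * complex_of_real (measure M (cylinder \<Lambda> (cmp \<Lambda> \<eta> l)))"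
      using l finite_D_paths by simp
    also have "\<dots> = ?s * complex_of_real (inverse ?r) * (cnj (c m' ?v l) * ?w)"
      using measure_cmp_D_paths[OF \<eta> l] by simp
    finally have inner: "L2_inner M (Theta \<Lambda> (cmp \<Lambda> \<eta> l)) (psi c \<eta> m') =
      ?s * complex_of_real (inverse ?r) * (cnj (c m' ?v l) * ?w)" .
    have "(?s * c m ?v l) * L2_inner M (Theta \<Lambda> (cmp \<Lambda> \<eta> l)) (psi c \<eta> m') =
      (?s * ?s * complex_of_real (inverse ?r)) * (cnj (c m' ?v l) * c m ?v l * ?w)"
      unfolding inner by (simp only: mult_ac)
    moreover have "?s * ?s * complex_of_real (inverse ?r) = 1"
      using rho_pow_pos[of "deg \<Lambda> \<eta>"] by (simp flip: of_real_mult of_real_inverse)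
    ultimately show "(?s * c m ?v l) * L2_inner M (Theta \<Lambda> (cmp \<Lambda> \<eta> l)) (psi c \<eta> m') = cnj (c m' ?v l) * c m ?v l * ?w"
      by (simp only: mult_1_left)
  qed
  \<comment> \<open>The indices are swapped because \<open>L2_inner\<close> conjugates its second
    argument and \<open>D_inner\<close> its first.\<close>
  also have "\<dots> = D_inner \<Lambda> xL ?v (c m' ?v) (c m ?v)"
    by (simp only: D_inner_def)
  also have "\<dots> = (if m = m' then 1 else 0)"
    using coeffs_orthonormal[OF src_vertex[OF \<eta>] m(2,1)] by auto
  finally show ?thesis .
qed

section \<open>The subspaces of the decomposition and their generators\<close>

definition psi_level :: "nat \<Rightarrow> (('a, 'k) inf_path \<Rightarrow> complex) set" where
  "psi_level j = {psi c \<eta> m | \<eta> m. \<eta> \<in> mor \<Lambda> \<and> deg \<Lambda> \<eta> = diag j \<and> m \<in> wavelet_indices \<Lambda> (src \<Lambda> \<eta>)}"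

definition V0_gen :: "(('a, 'k) inf_path \<Rightarrow> complex) set" where
  "V0_gen = {(\<lambda>x. complex_of_real (1 / sqrt (xL v)) * Theta \<Lambda> v x) | v. v \<in> vertices \<Lambda>}"

lemma psi_level_L2: "psi_level j \<subseteq> L2 M"
  by (auto simp: psi_level_def psi_L2)

lemma V0_gen_L2: "V0_gen \<subseteq> L2 M"
  unfolding V0_gen_def by (blast intro: L2_cmult Theta_L2 vertexD(1))

text \<open>For j = 0 the generating sets coincide by \<open>psi_vertex\<close>. For positive j the
  generators are matched only almost everywhere, so it is the closed spans that are
  compared.\<close>

lemma W_eq: "W \<Lambda> c M j = closed_span M (psi_level j)"
proof (cases "j = 0")
  case True
  have "psi_level 0 = {wavelet \<Lambda> c m v | m v. v \<in> vertices \<Lambda> \<and> m \<in> wavelet_indices \<Lambda> v}" (is "?A = ?B")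
  proof
    show "?A \<subseteq> ?B"
    proof
      fix f assume "f \<in> ?A"
      then obtain \<eta> m where "f = psi c \<eta> m" "\<eta> \<in> mor \<Lambda>" "deg \<Lambda> \<eta> = 0" "m \<in> wavelet_indices \<Lambda> (src \<Lambda> \<eta>)"
        by (auto simp: psi_level_def diag_zero)
      then show "f \<in> ?B"
        using deg_zero_vertex[of \<eta>] psi_vertex[of \<eta>] vertexD(3)[of \<eta>] by auto
    qed
    show "?B \<subseteq> ?A"
    proof
      fix f assume "f \<in> ?B"
      then obtain v m where v: "f = wavelet \<Lambda> c m v" "v \<in> vertices \<Lambda>" "m \<in> wavelet_indices \<Lambda> v"
        by blast
      then show "f \<in> ?A"
        unfolding psi_level_def using vertexD[OF v(2)] psi_vertex[OF v(2)] deg_vertex[OF v(2)]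
        by (intro CollectI exI[of _ v] exI[of _ m]) (auto simp: diag_zero)
    qed
  qed
  then show ?thesis
    using True by (simp add: W_def)
next
  case False
  let ?B = "{S_op \<Lambda> M \<eta> (wavelet \<Lambda> c m v) | \<eta> m v.
             v \<in> vertices \<Lambda> \<and> \<eta> \<in> C_paths \<Lambda> j v \<and> m \<in> wavelet_indices \<Lambda> v}"
  have B: "?B \<subseteq> L2 M"
    using S_op_wavelet_L2 by (auto simp: C_paths_def)
  have "closed_span M ?B = closed_span M (psi_level j)"
  proof
    show "closed_span M ?B \<subseteq> closed_span M (psi_level j)"
    proof (rule closed_span_least[OF psi_level_L2], rule subsetI)
      fix f assume "f \<in> ?B"
      then obtain \<eta> m where \<eta>: "f = S_op \<Lambda> M \<eta> (wavelet \<Lambda> c m (src \<Lambda> \<eta>))" "\<eta> \<in> mor \<Lambda>" "deg \<Lambda> \<eta> = diag j"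
        "m \<in> wavelet_indices \<Lambda> (src \<Lambda> \<eta>)"
        by (auto simp: C_paths_def)
      have p: "psi c \<eta> m \<in> closed_span M (psi_level j)"
        using \<eta> by (intro closed_span_base[OF psi_level_L2]) (auto simp: psi_level_def)
      show "f \<in> closed_span M (psi_level j)"
        unfolding \<eta>(1)
        using S_op_wavelet_AE[OF \<eta>(2), of c m]
        by (intro closed_span_cong_AE[OF psi_level_L2 p] S_op_measurable \<eta> wavelet_measurable) (auto elim: eventually_mono)
    qed
    show "closed_span M (psi_level j) \<subseteq> closed_span M ?B"
    proof (rule closed_span_least[OF B], rule subsetI)
      fix f assume "f \<in> psi_level j"
      then obtain \<eta> m where \<eta>: "f = psi c \<eta> m" "\<eta> \<in> mor \<Lambda>" "deg \<Lambda> \<eta> = diag j" "m \<in> wavelet_indices \<Lambda> (src \<Lambda> \<eta>)"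
        by (auto simp: psi_level_def)
      have "S_op \<Lambda> M \<eta> (wavelet \<Lambda> c m (src \<Lambda> \<eta>)) \<in> ?B"
        using \<eta> src_vertex by (auto simp: C_paths_def)
      then have p: "S_op \<Lambda> M \<eta> (wavelet \<Lambda> c m (src \<Lambda> \<eta>)) \<in> closed_span M ?B"
        by (rule closed_span_base[OF B])
      show "f \<in> closed_span M ?B"
        unfolding \<eta>(1) by (intro closed_span_cong_AE[OF B p] S_op_wavelet_AE \<eta> L2_meas psi_L2)
    qed
  qed
  then show ?thesis
    using False by (simp add: W_def)
qed

lemma V0_eq: "V0 \<Lambda> xL M = closed_span M V0_gen"
  by (simp add: V0_def V0_gen_def)

text \<open>The function of the higher level comes first: its generators have mean zero on cylinders
  where those of the lower level are constant.\<close>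

lemma W_orthogonal:
  assumes "i < j" "f \<in> W \<Lambda> c M i" "g \<in> W \<Lambda> c M j"
  shows "L2_inner M g f = 0"
proof (rule closed_spans_orthogonal[OF psi_level_L2 psi_level_L2])
  show "g \<in> closed_span M (psi_level j)" "f \<in> closed_span M (psi_level i)"
    using assms by (simp_all add: W_eq)
  fix b d assume "b \<in> psi_level j" "d \<in> psi_level i"
  then show "L2_inner M b d = 0"
    using psi_orthogonal psi_constant[of _ j _ i] assms(1) unfolding psi_level_def by force
qed

lemma V0_W_orthogonal:
  assumes "f \<in> V0 \<Lambda> xL M" "g \<in> W \<Lambda> c M j"
  shows "L2_inner M g f = 0"
proof (rule closed_spans_orthogonal[OF psi_level_L2 V0_gen_L2])
  show "g \<in> closed_span M (psi_level j)" "f \<in> closed_span M V0_gen"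
    using assms by (simp_all add: W_eq V0_eq)
  fix b d assume "b \<in> psi_level j" "d \<in> V0_gen"
  then obtain \<eta> m v where \<eta>: "b = psi c \<eta> m" "\<eta> \<in> mor \<Lambda>" "m \<in> wavelet_indices \<Lambda> (src \<Lambda> \<eta>)"
    and v: "d = (\<lambda>x. complex_of_real (1 / sqrt (xL v)) * Theta \<Lambda> v x)" "v \<in> vertices \<Lambda>"
    by (auto simp: psi_level_def V0_gen_def)
  have "cylinder \<Lambda> \<eta> \<subseteq> cylinder \<Lambda> v \<or> cylinder \<Lambda> \<eta> \<inter> cylinder \<Lambda> v = {}"
    using vertexD(1)[OF v(2)] deg_vertex[OF v(2)] by (intro cylinder_cases \<eta>(2)) (auto simp: vec_nat_zero_le)
  then have "\<exists>k. \<forall>x\<in>cylinder \<Lambda> \<eta>. d x = k"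
    unfolding v(1) Theta_def by (auto simp: indicator_def subset_iff disjoint_iff)
  then show "L2_inner M b d = 0"
    unfolding \<eta>(1) by (rule psi_orthogonal[OF \<eta>(2,3)])
qed

lemma generators_L2: "V0_gen \<union> (\<Union>j. psi_level j) \<subseteq> L2 M"
  using V0_gen_L2 psi_level_L2 by blast

text \<open>With \<eta> = \<mu>l, prefixing by \<mu> transports the splitting of the coordinate
  vector of l: the constant part becomes a multiple of \<open>Theta \<Lambda> \<mu>\<close>, one
  level lower, and the remainder a combination of the \<open>psi c \<mu> m\<close>.\<close>

lemma Theta_in_decomposition:
  assumes "\<eta> \<in> mor \<Lambda>" "deg \<Lambda> \<eta> = diag n"
  shows "Theta \<Lambda> \<eta> \<in> closed_span M (V0_gen \<union> (\<Union>j. psi_level j))"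
  using assms
proof (induction n arbitrary: \<eta>)
  case 0
  then have v: "\<eta> \<in> vertices \<Lambda>"
    using deg_zero_vertex by (simp add: diag_zero)
  let ?f = "\<lambda>x. complex_of_real (1 / sqrt (xL \<eta>)) * Theta \<Lambda> \<eta> x"
  have "?f \<in> closed_span M (V0_gen \<union> (\<Union>j. psi_level j))"
    using v by (intro closed_span_base[OF generators_L2]) (auto simp: V0_gen_def)
  then have "(\<lambda>x. complex_of_real (sqrt (xL \<eta>)) * ?f x) \<in> closed_span M (V0_gen \<union> (\<Union>j. psi_level j))"
    by (rule closed_span_cmult)
  moreover have "(\<lambda>x. complex_of_real (sqrt (xL \<eta>)) * ?f x) = Theta \<Lambda> \<eta>"
    using xL_pos[OF v] by (simp add: fun_eq_iff)
  ultimately show ?case by simp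
next
  case (Suc n)
  have "deg \<Lambda> \<eta> = diag n + diag 1"
    using Suc.prems(2) diag_add[of n 1] by simp
  then obtain \<mu> l where \<mu>: "\<mu> \<in> mor \<Lambda>" "deg \<Lambda> \<mu> = diag n" "\<eta> = cmp \<Lambda> \<mu> l"
    and l: "l \<in> D_paths \<Lambda> (src \<Lambda> \<mu>)"
  proof (rule factorization_obtain[OF Suc.prems(1)])
    fix \<mu> l
    assume "\<mu> \<in> mor \<Lambda>" "l \<in> mor \<Lambda>" "src \<Lambda> \<mu> = rng \<Lambda> l" "\<eta> = cmp \<Lambda> \<mu> l"
      "deg \<Lambda> \<mu> = diag n" "deg \<Lambda> l = diag 1"
    then show thesis
      by (auto intro!: that[of \<mu> l] simp: D_paths_def)
  qed
  let ?v = "src \<Lambda> \<mu>" and ?s = "complex_of_real (sqrt (rho_pow \<Lambda> (deg \<Lambda> \<mu>)))"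
  let ?D = "D_paths \<Lambda> ?v"
  let ?w = "\<lambda>l. complex_of_real (inverse (rho_pow \<Lambda> (diag 1)) * xL (src \<Lambda> l))"
  have v: "?v \<in> vertices \<Lambda>"
    using \<mu>(1) by (rule src_vertex)
  define t where "t = (\<Sum>l'\<in>?D. ?w l')"
  have "0 < (\<Sum>l'\<in>?D. inverse (rho_pow \<Lambda> (diag 1)) * xL (src \<Lambda> l'))"
    using l finite_D_paths xL_pos[OF src_vertex[OF D_pathsD(1)]] rho_pow_pos[of "diag 1"]
    by (intro sum_pos) auto
  then have t: "t \<noteq> 0"
    unfolding t_def of_real_sum[symmetric] of_real_eq_0_iff by (rule less_imp_neq[symmetric])
  \<comment> \<open>The vector \<alpha>(1, ..., 1) is the orthogonal projection of the coordinate
    vector of l onto the constants: t is the squared norm of (1, ..., 1), and \<open>?w l\<close>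
    the inner product of the two vectors.\<close>
  define \<alpha> where "\<alpha> = ?w l / t"
  define u where "u = (\<lambda>l'. (if l' = l then 1 else 0) - \<alpha>)"
  have "D_inner \<Lambda> xL ?v (\<lambda>_. 1) u = (\<Sum>l'\<in>?D. (if l' = l then ?w l' else 0) - \<alpha> * ?w l')"
    unfolding D_inner_def u_def by (rule sum.cong[OF refl]) (simp add: left_diff_distrib)
  also have "\<dots> = ?w l - \<alpha> * t"
    using l finite_D_paths by (simp only: sum_subtractf t_def sum_distrib_left) simp
  also have "\<dots> = 0"
    using t by (simp add: \<alpha>_def)
  finally obtain a where a: "\<And>l'. l' \<in> ?D \<Longrightarrow> u l' = (\<Sum>m \<in> wavelet_indices \<Lambda> ?v. a m * c m ?v l')"
    using coeffs_span[OF v] by blast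
  \<comment> \<open>Division by \<open>?s\<close> removes the normalizing factor built into
    \<open>psi\<close>.\<close>
  let ?f = "\<lambda>x. \<alpha> * Theta \<Lambda> \<mu> x + (\<Sum>m \<in> wavelet_indices \<Lambda> ?v. (a m / ?s) * psi c \<mu> m x)"
  have s0: "?s \<noteq> 0"
    using rho_pow_pos[of "deg \<Lambda> \<mu>"] by simp
  have "Theta \<Lambda> \<eta> x = ?f x" for x
  proof (cases "x \<in> cylinder \<Lambda> \<mu>")
    case False
    then show ?thesis
      using psi_outside[OF \<mu>(1) False] cmp_D_paths(4)[OF \<mu>(1) l] \<mu>(3) by (auto simp: Theta_def indicator_def)
  next
    case True
    \<comment> \<open>Exactly one extension p of \<mu> is followed by x, so sums over
      \<open>?D\<close> collapse to their term at p and the claim becomes the vector identity in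
      that coordinate.\<close>
    obtain p where p: "p \<in> ?D" "x \<in> cylinder \<Lambda> (cmp \<Lambda> \<mu> p)"
      using cylinder_split[OF True] by blast
    have Th: "Theta \<Lambda> (cmp \<Lambda> \<mu> l') x = (if l' = p then 1 else 0)" if l': "l' \<in> ?D" for l'
    proof (cases "l' = p")
      case False
      have "cylinder \<Lambda> (cmp \<Lambda> \<mu> l') \<inter> cylinder \<Lambda> (cmp \<Lambda> \<mu> p) = {}"
        by (rule D_paths_disjoint[OF \<mu>(1) l' p(1) False])
      then show ?thesis
        using p(2) False by (auto simp: Theta_def indicator_def)
    qed (use p(2) in \<open>simp add: Theta_def\<close>)
    have psi: "psi c \<mu> m x = ?s * c m ?v p" for m
    proof -
      have "psi c \<mu> m x = (\<Sum>l'\<in>?D. if l' = p then ?s * c m ?v p else 0)"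
        unfolding psi_def by (rule sum.cong[OF refl]) (simp add: Th)
      then show ?thesis
        using p(1) finite_D_paths by simp
    qed
    have "?f x = \<alpha> + (\<Sum>m \<in> wavelet_indices \<Lambda> ?v. a m * c m ?v p)"
      using True s0 by (simp add: psi Theta_def)
    also have "\<dots> = \<alpha> + u p"
      using a[OF p(1)] by simp
    also have "\<dots> = Theta \<Lambda> \<eta> x"
      using Th[OF l] by (simp add: u_def \<mu>(3))
    finally show ?thesis by simp
  qed
  then have "Theta \<Lambda> \<eta> = ?f"
    by (rule ext)
  moreover have "?f \<in> closed_span M (V0_gen \<union> (\<Union>j. psi_level j))"
  proof (intro closed_span_add[OF generators_L2] closed_span_sum[OF generators_L2] closed_span_cmult)
    show "Theta \<Lambda> \<mu> \<in> closed_span M (V0_gen \<union> (\<Union>j. psi_level j))"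
      using Suc.IH[OF \<mu>(1,2)] .
    show "psi c \<mu> m \<in> closed_span M (V0_gen \<union> (\<Union>j. psi_level j))" if "m \<in> wavelet_indices \<Lambda> ?v" for m
      using that \<mu> by (intro closed_span_base[OF generators_L2]) (auto simp: psi_level_def)
  qed
  ultimately show ?case by simp
qed

lemma L2_eq_diag: "L2 M = closed_span M (diag_cylinder_functions \<Lambda>)"
proof (rule L2_eq_closed_span_indicators[OF finite_measure_M diag_cylinders_Int_stable diag_cylinders_sub sets_M])
  show B: "diag_cylinder_functions \<Lambda> \<subseteq> L2 M"
    by (auto simp: diag_cylinder_functions_def Theta_L2)
  have base: "(indicator (cylinder \<Lambda> \<eta>) :: _ \<Rightarrow> complex) \<in> closed_span M (diag_cylinder_functions \<Lambda>)"
    if "\<eta> \<in> mor \<Lambda>" "deg \<Lambda> \<eta> = diag n" for \<eta> n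
    using that by (intro closed_span_base[OF B]) (auto simp: diag_cylinder_functions_def Theta_def)
  show "(indicator A :: _ \<Rightarrow> complex) \<in> closed_span M (diag_cylinder_functions \<Lambda>)" if "A \<in> diag_cylinders" for A
  proof (cases "A = {}")
    case True
    then have "(indicator A :: _ \<Rightarrow> complex) = (\<lambda>_. 0)"
      by (simp add: fun_eq_iff)
    then show ?thesis
      by (simp only: closed_span_zero)
  next
    case False
    then show ?thesis
      using that base by (auto simp: diag_cylinders_def)
  qed
  \<comment> \<open>The whole space need not be a diagonal cylinder; it is the disjoint union of the
    finitely many vertex cylinders.\<close>
  have "(\<Sum>v\<in>vertices \<Lambda>. indicator (cylinder \<Lambda> v) x) = (indicator (space M) x :: complex)" for x
  proof (cases "x \<in> infinite_paths \<Lambda>")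
    case True
    have v: "x (0, 0) \<in> vertices \<Lambda>"
      using infinite_pathD(1,2)[OF True, of 0 0] rng_vertex by force
    have "(\<Sum>v\<in>vertices \<Lambda>. indicator (cylinder \<Lambda> v) x) = (\<Sum>v\<in>vertices \<Lambda>. if v = x (0, 0) then 1 else (0 :: complex))"
      using True by (intro sum.cong) (auto simp: cylinder_def deg_vertex indicator_def)
    then show ?thesis
      using v finite_vertices True by (simp add: space_M)
  qed (auto simp: space_M cylinder_def indicator_def)
  moreover have "(\<lambda>x. \<Sum>v\<in>vertices \<Lambda>. indicator (cylinder \<Lambda> v) x :: complex) \<in> closed_span M (diag_cylinder_functions \<Lambda>)"
    using vertexD(1) deg_vertex by (intro closed_span_sum[OF B] base[of _ 0]) (auto simp: diag_zero)
  ultimately show "(indicator (space M) :: _ \<Rightarrow> complex) \<in> closed_span M (diag_cylinder_functions \<Lambda>)"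
    by simp
qed

text \<open>The type \<open>nat option\<close> provides one index besides the levels:
  \<open>None\<close> stands for \<open>V0\<close> and \<open>Some j\<close> for level j. Density
  holds because the diagonal indicators span L^2 and lie in the closed span of the
  generators.\<close>

lemma decomposition: "orthogonal_direct_sum M (L2 M) UNIV (case_option (V0 \<Lambda> xL M) (W \<Lambda> c M))"
  (is "orthogonal_direct_sum M _ _ ?E")
  unfolding orthogonal_direct_sum_def
proof (intro conjI ballI impI)
  fix i :: "nat option"
  show sub: "?E i \<subseteq> L2 M"
    by (cases i) (simp_all add: V0_eq W_eq closed_span_L2)
  show "closed_span M (?E i) = ?E i"
    by (cases i) (simp_all add: V0_eq W_eq closed_span_idem V0_gen_L2 psi_level_L2)
next
  fix i j f g assume ij: "i \<noteq> j" and f: "f \<in> ?E i" and g: "g \<in> ?E j"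
  have sym: "L2_inner M f g = 0" if "L2_inner M g f = 0"
    using that by (subst L2_inner_cnj) simp
  show "L2_inner M f g = 0"
  proof (cases i; cases j)
    fix a assume "i = None" "j = Some a"
    then show ?thesis
      using f g V0_W_orthogonal sym by simp
  next
    fix a assume "i = Some a" "j = None"
    then show ?thesis
      using f g V0_W_orthogonal by simp
  next
    fix a b assume ab: "i = Some a" "j = Some b"
    with ij have "a < b \<or> b < a" by auto
    then show ?thesis
      using ab f g W_orthogonal sym by auto
  qed (use ij in auto)
next
  let ?B = "V0_gen \<union> (\<Union>j. psi_level j)" and ?U = "\<Union>i\<in>UNIV. ?E i"
  have "?E i \<subseteq> L2 M" for i
    by (cases i) (simp_all add: V0_eq W_eq closed_span_L2)
  then have U: "?U \<subseteq> L2 M"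
    by blast
  have "V0_gen \<subseteq> ?E None"
    using closed_span_base[OF V0_gen_L2] by (auto simp: V0_eq)
  moreover have "psi_level j \<subseteq> ?E (Some j)" for j
    using closed_span_base[OF psi_level_L2] by (auto simp: W_eq)
  ultimately have "?B \<subseteq> ?U"
    by blast
  then have "?B \<subseteq> closed_span M ?U"
    using closed_span_base[OF U] by (meson subset_iff)
  then have "closed_span M ?B \<subseteq> closed_span M ?U"
    by (rule closed_span_least[OF U])
  moreover have "diag_cylinder_functions \<Lambda> \<subseteq> closed_span M ?B"
    using Theta_in_decomposition unfolding diag_cylinder_functions_def by blast
  ultimately have "closed_span M (diag_cylinder_functions \<Lambda>) \<subseteq> closed_span M ?U"
    using U by (intro closed_span_least) auto
  then show "L2 M = closed_span M ?U"
    using L2_eq_diag closed_span_L2 by blast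
qed

end

theorem theorem4p2:
  fixes \<Lambda> :: "('a, 'k::finite) kgraph"
    and xL :: "'a \<Rightarrow> real"
    and M :: "('a, 'k) inf_path measure"
    and c :: "nat \<Rightarrow> 'a \<Rightarrow> 'a \<Rightarrow> complex"
  assumes "k_graph \<Lambda>"
    and "finite_kgraph \<Lambda>"
    and "strongly_connected \<Lambda>"
    and "pf_vector \<Lambda> xL"
    and "pf_measure \<Lambda> xL M"
    and "wavelet_coeffs \<Lambda> xL c"
  shows
    "(\<forall>j \<ge> 1. orthonormal_family M
        {(v, \<eta>, m). v \<in> vertices \<Lambda> \<and> \<eta> \<in> C_paths \<Lambda> j v \<and> m \<in> wavelet_indices \<Lambda> v}
        (\<lambda>(v, \<eta>, m). S_op \<Lambda> M \<eta> (wavelet \<Lambda> c m v))) \<and>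
     (\<forall>i j. \<forall>v \<in> vertices \<Lambda>. \<forall>v' \<in> vertices \<Lambda>. \<forall>\<eta> \<in> C_paths \<Lambda> j v. \<forall>\<mu> \<in> C_paths \<Lambda> i v'.
        0 < i \<longrightarrow> i < j \<longrightarrow>
        (\<forall>m \<in> wavelet_indices \<Lambda> v. \<forall>m' \<in> wavelet_indices \<Lambda> v'.
           (\<integral>x. S_op \<Lambda> M \<eta> (wavelet \<Lambda> c m v) x * cnj (S_op \<Lambda> M \<mu> (wavelet \<Lambda> c m' v') x) \<partial>M) = 0)) \<and>
     L2 M = closed_span M (diag_cylinder_functions \<Lambda>) \<and>
     orthogonal_direct_sum M (L2 M) UNIV (case_option (V0 \<Lambda> xL M) (W \<Lambda> c M))"
proof -
  interpret k_graph \<Lambda> by fact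
  interpret pf_wavelets \<Lambda> xL M c
    by unfold_locales (fact assms)+
  have orth: "L2_inner M (S_op \<Lambda> M \<eta> (wavelet \<Lambda> c m v)) (S_op \<Lambda> M \<mu> (wavelet \<Lambda> c m' v')) = 0"
    if "\<eta> \<in> C_paths \<Lambda> j v" "\<mu> \<in> C_paths \<Lambda> i v'" "m \<in> wavelet_indices \<Lambda> v" "i < j \<or> i = j \<and> \<mu> \<noteq> \<eta>"
    for i j v v' \<eta> \<mu> m m'
  proof -
    have \<eta>: "\<eta> \<in> mor \<Lambda>" "deg \<Lambda> \<eta> = diag j" "src \<Lambda> \<eta> = v" and \<mu>: "\<mu> \<in> mor \<Lambda>" "deg \<Lambda> \<mu> = diag i" "src \<Lambda> \<mu> = v'"
      using that by (auto simp: C_paths_def)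
    show ?thesis
      using L2_inner_S_op[OF \<eta>(1) \<mu>(1)] psi_orthogonal[OF \<eta>(1) _ psi_constant[OF \<eta>(1,2) \<mu>(1,2) that(4)]]
        \<eta>(3) \<mu>(3) that(3) by simp
  qed
  have "orthonormal_family M
        {(v, \<eta>, m). v \<in> vertices \<Lambda> \<and> \<eta> \<in> C_paths \<Lambda> j v \<and> m \<in> wavelet_indices \<Lambda> v}
        (\<lambda>(v, \<eta>, m). S_op \<Lambda> M \<eta> (wavelet \<Lambda> c m v))" (is "orthonormal_family M ?I ?f") for j
    unfolding orthonormal_family_def
  proof (intro conjI ballI)
    fix a assume "a \<in> ?I"
    then show "?f a \<in> L2 M"
      using S_op_wavelet_L2 by (auto simp: C_paths_def)
  next
    fix a b assume "a \<in> ?I" "b \<in> ?I"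
    then obtain v \<eta> m v' \<mu> m' where a: "a = (v, \<eta>, m)" "\<eta> \<in> C_paths \<Lambda> j v" "m \<in> wavelet_indices \<Lambda> v"
      and b: "b = (v', \<mu>, m')" "\<mu> \<in> C_paths \<Lambda> j v'" "m' \<in> wavelet_indices \<Lambda> v'"
      by blast
    \<comment> \<open>The vertex in an index is the source of its path, so triples with equal paths
      can differ only in m.\<close>
    show "L2_inner M (?f a) (?f b) = (if a = b then 1 else 0)"
    proof (cases "\<mu> = \<eta>")
      case True
      have "\<eta> \<in> mor \<Lambda>" "src \<Lambda> \<eta> = v" "v' = v"
        using a(2) b(2) True by (auto simp: C_paths_def)
      then show ?thesis
        using L2_inner_S_op[of \<eta> \<eta> c m m'] psi_orthonormal[of \<eta> m m'] a b True by simp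
    next
      case False
      then show ?thesis
        using orth[OF a(2) b(2) a(3)] a(1) b(1) by simp
    qed
  qed
  moreover have "(\<integral>x. S_op \<Lambda> M \<eta> (wavelet \<Lambda> c m v) x * cnj (S_op \<Lambda> M \<mu> (wavelet \<Lambda> c m' v') x) \<partial>M) = 0"
    if "\<eta> \<in> C_paths \<Lambda> j v" "\<mu> \<in> C_paths \<Lambda> i v'" "i < j" "m \<in> wavelet_indices \<Lambda> v" for i j v v' \<eta> \<mu> m m'
    using orth[of \<eta> j v \<mu> i v' m m'] that by (simp add: L2_inner_def)
  ultimately show ?thesis
    using L2_eq_diag decomposition by blast
qed

end
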